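(* For a positive integer $n$, let $r_3(n)$ be the number of representations of $n$ as a sum of three squares of integers. Then, as $x \to \infty$, $$\sum_{n \le x} r_3(n)^2 \sim \frac{8\pi^4}{21\,\zeta(3)}\, x^2,$$ where the sum runs over positive integers $n \le x$.
   Context: Representations are counted with signs and order: $r_3(n)$ is the number of triples $(x_1,x_2,x_3) \in \mathbb{Z}^3$ with $x_1^2+x_2^2+x_3^2=n$. Here $\zeta$ is the Riemann zeta function, and $f(x)\sim g(x)$ as $x\to\infty$ means $f(x)/g(x)\to 1$. *)

theory Defs
  imports "HOL-Analysis.Analysis" "HOL-Library.Landau_Symbols"
begin

definition r3 :: "nat \<Rightarrow> nat" where
  "r3 n = card {(x1::int, x2::int, x3::int). x1\<^sup>2 + x2\<^sup>2 + x3\<^sup>2 = int n}"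

text \<open>The cardinality above is that of a finite set, so it is not the default value 0.\<close>

lemma finite_three_squares_reps:
  "finite {(x1::int, x2::int, x3::int). x1\<^sup>2 + x2\<^sup>2 + x3\<^sup>2 = int n}"
proof (rule finite_subset)
  have bound: "\<bar>x\<bar> \<le> int n" if "x\<^sup>2 \<le> int n" for x :: int
  proof -
    have "\<bar>x\<bar> \<le> x\<^sup>2"
      using mult_left_mono[of 1 "\<bar>x\<bar>" "\<bar>x\<bar>"]
      by (cases "x = 0") (auto simp: power2_eq_square)
    with that show ?thesis by linarith
  qed
  show "{(x1::int, x2::int, x3::int). x1\<^sup>2 + x2\<^sup>2 + x3\<^sup>2 = int n}
      \<subseteq> {- int n..int n} \<times> {- int n..int n} \<times> {- int n..int n}"
  proof (clarsimp simp del: atLeastAtMost_iff)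
    fix x1 x2 x3 :: int
    assume eq: "x1\<^sup>2 + x2\<^sup>2 + x3\<^sup>2 = int n"
    have nn: "0 \<le> x1\<^sup>2" "0 \<le> x2\<^sup>2" "0 \<le> x3\<^sup>2" by simp_all
    have "\<bar>x1\<bar> \<le> int n" "\<bar>x2\<bar> \<le> int n" "\<bar>x3\<bar> \<le> int n"
      using eq nn by (intro bound; linarith)+
    then show "x1 \<in> {- int n..int n} \<and> x2 \<in> {- int n..int n} \<and> x3 \<in> {- int n..int n}"
      by auto
  qed
qed simp

text \<open>The Riemann zeta function on the real half-line \<open>s > 1\<close>, where it is given by its
  Dirichlet series; for other \<open>s\<close> this definition has no meaning.\<close>

definition riemann_zeta :: "real \<Rightarrow> real" where
  "riemann_zeta s = (\<Sum>n. 1 / real (Suc n) powr s)"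

lemma riemann_zeta_sums:
  assumes "s > 1"
  shows "(\<lambda>n. 1 / real (Suc n) powr s) sums riemann_zeta s"
proof -
  have "summable (\<lambda>n. real n powr (- s))"
    using assms by (simp add: summable_real_powr_iff)
  then have "summable (\<lambda>n. real (Suc n) powr (- s))"
    by (subst summable_Suc_iff)
  then have "summable (\<lambda>n. 1 / real (Suc n) powr s)"
    by (simp add: powr_minus_divide)
  then show ?thesis
    unfolding riemann_zeta_def by (rule summable_sums)
qed

end

theory Submission
  imports Defs "HOL-Number_Theory.Totient" "HOL-Real_Asymp.Real_Asymp"
begin

text \<open>
  The sum counts pairs \<open>(x, y)\<close> of integer vectors with \<open>|x|\<^sup>2 = |y|\<^sup>2 = n\<close>. In the coordinates \<open>u = x - y\<close>,
  \<open>v = x + y\<close> the condition \<open>|x| = |y|\<close> becomes the bilinear equation \<open>u \<bullet> v = 0\<close>, together with \<open>u \<equiv> v\<close>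
  modulo 2 and \<open>|u|\<^sup>2 + |v|\<^sup>2 = 4 n\<close> (lemma \<open>sum_r3_squared_eq_card_orthogonal_pairs\<close>). So if \<open>R\<^sup>2\<close> is four times
  the bound on \<open>n\<close>, the task is to count, for each \<open>u\<close> in the ball of radius \<open>R\<close>, the points \<open>v\<close> of a plane lattice coset in a disc of
  radius \<open>sqrt (R\<^sup>2 - |u|\<^sup>2)\<close>; this is pure geometry of numbers.

  Write \<open>u = d u'\<close> with \<open>d\<close> the gcd of the coordinates. The coset is empty if \<open>|u|\<^sup>2\<close> is odd, and otherwise
  is a translate of \<open>2 L\<close>, where \<open>L\<close> is the lattice of integer vectors orthogonal to \<open>u'\<close>. A basis \<open>a, b\<close> of
  \<open>L\<close> with \<open>a \<times> b = u'\<close> shows that \<open>L\<close> has covolume \<open>|u'|\<close>, and if \<open>a\<close> is a shortest vector and \<open>b\<close> is reduced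
  against it, the count differs from area over covolume by \<open>O(R / |a| + 1)\<close> (lemma \<open>card_fibre\<close>). This
  error is summable: for fixed \<open>T\<close> only \<open>O(T\<^sup>3 R\<^sup>2)\<close> of the \<open>O(R\<^sup>3)\<close> vectors \<open>u\<close> are orthogonal to a nonzero vector
  shorter than \<open>T\<close>, so the total error is at most \<open>O(R\<^sup>4 / T) + o(R\<^sup>4)\<close>, and \<open>T\<close> is arbitrary
  (lemma \<open>card_orthogonal_pairs_estimate\<close>).

  What remains is \<open>pi / 4\<close> times the sum of \<open>gcd(u) (R\<^sup>2 - |u|\<^sup>2) / |u|\<close> over nonzero \<open>u\<close> with even \<open>|u|\<^sup>2\<close>.
  Writing the gcd as a sum of \<open>totient n\<close> over its divisors \<open>n\<close> and substituting \<open>u = n w\<close> turns it into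
  a sum over \<open>n\<close> of radial sums over a full lattice: \<open>\<int>\<^sup>3\<close> for even \<open>n\<close>, and the index-two sublattice of vectors
  with even coordinate sum for odd \<open>n\<close>. Each of these is asymptotic to its volume integral
  (lemma \<open>radial_sum_asymptotics\<close>), and Tannery's theorem allows the limit to be taken termwise. The
  resulting constant is a totient Dirichlet series at 3, which equals \<open>(4 / 7) \<zeta>(2) / \<zeta>(3)\<close> because
  \<open>totient * 1 = id\<close> under Dirichlet convolution (lemma \<open>totient_dens_sums\<close>).
\<close>

section \<open>Sums of monotone functions and lattice points in ellipses\<close>

text \<open>
  Comparison of a sum with an integral, where the integral is given by an antiderivative \<open>H\<close>. By the mean
  value theorem \<open>H (x + 1) - H x\<close> lies between \<open>h (x + 1)\<close> and \<open>h x\<close>, so the sum telescopes up to one extra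
  term. Differentiability is asked for in the open interval because the antiderivative of a semicircle
  contains an arcsine, which has no derivative at 1.
\<close>

lemma sum_antimono_half_line:
  fixes h H :: "real \<Rightarrow> real" and \<beta> \<rho> :: real
  assumes \<beta>: "0 \<le> \<beta>" "\<beta> \<le> 1" and \<rho>: "0 \<le> \<rho>"
    and anti: "\<And>x y. 0 \<le> x \<Longrightarrow> x \<le> y \<Longrightarrow> y \<le> \<rho> \<Longrightarrow> h y \<le> h x"
    and nonneg: "h \<rho> \<ge> 0"
    and cont: "continuous_on {0..\<rho>} H"
    and deriv: "\<And>x. 0 < x \<Longrightarrow> x < \<rho> \<Longrightarrow> (H has_real_derivative h x) (at x)"
  shows "\<bar>(\<Sum>k::nat | real k + \<beta> \<le> \<rho>. h (real k + \<beta>)) - (H \<rho> - H 0)\<bar> \<le> h 0"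
proof -
  have mv: "h y * (y - x) \<le> H y - H x \<and> H y - H x \<le> h x * (y - x)"
    if xy: "0 \<le> x" "x \<le> y" "y \<le> \<rho>" for x y
  proof (cases "x = y")
    case False
    have "continuous_on {x..y} H" using cont xy by (rule_tac continuous_on_subset) auto
    moreover have "H differentiable (at z)" if "x < z" "z < y" for z
      using deriv[of z] that xy real_differentiable_def by fastforce
    ultimately obtain l z where z: "x < z" "z < y" "(H has_real_derivative l) (at z)"
        "H y - H x = (y - x) * l"
      using MVT[of x y H] False xy by force
    have "l = h z" using z deriv[of z] xy DERIV_unique by fastforce
    moreover have "h y \<le> h z" "h z \<le> h x" using anti[of z y] anti[of x z] z xy by auto
    ultimately show ?thesis using z by (auto simp: mult.commute intro!: mult_left_mono)
  qed auto
  have hnn: "h x \<ge> 0" if "0 \<le> x" "x \<le> \<rho>" for x using anti[of x \<rho>] nonneg that by linarith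
  show ?thesis
  proof (cases "\<beta> \<le> \<rho>")
    case False
    then have "{k::nat. real k + \<beta> \<le> \<rho>} = {}" by auto
    moreover have "0 \<le> H \<rho> - H 0 \<and> H \<rho> - H 0 \<le> h 0"
    proof -
      have "h 0 * \<rho> \<le> h 0 * 1" using False \<beta> hnn[of 0] \<rho> by (intro mult_left_mono) auto
      moreover have "0 \<le> h \<rho> * \<rho>" using nonneg \<rho> by simp
      ultimately show ?thesis using mv[of 0 \<rho>] \<rho> by auto
    qed
    ultimately show ?thesis by simp
  next
    case True
    define K where "K = nat \<lfloor>\<rho> - \<beta>\<rfloor>"
    have K: "real K + \<beta> \<le> \<rho>" "\<rho> < real K + 1 + \<beta>"
      using True unfolding K_def by linarith+
    have set: "{k::nat. real k + \<beta> \<le> \<rho>} = {..K}" using K by auto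
    have up: "(\<Sum>k\<le>j. h (real k + \<beta>)) \<le> h \<beta> + (H (real j + \<beta>) - H \<beta>)" if "j \<le> K" for j
      using that
    proof (induction j)
      case (Suc j)
      have "h (real (Suc j) + \<beta>) * ((real (Suc j) + \<beta>) - (real j + \<beta>)) \<le> H (real (Suc j) + \<beta>) - H (real j + \<beta>)"
        using mv[of "real j + \<beta>" "real (Suc j) + \<beta>"] Suc.prems K \<beta> by simp
      then show ?case using Suc by simp
    qed simp
    have lo: "(\<Sum>k<j. h (real k + \<beta>)) \<ge> H (real j + \<beta>) - H \<beta>" if "j \<le> K" for j
      using that
    proof (induction j)
      case (Suc j)
      have "h (real j + \<beta>) * ((real (Suc j) + \<beta>) - (real j + \<beta>)) \<ge> H (real (Suc j) + \<beta>) - H (real j + \<beta>)"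
        using mv[of "real j + \<beta>" "real (Suc j) + \<beta>"] Suc.prems K \<beta> by simp
      then show ?case using Suc by simp
    qed simp
    have split: "(\<Sum>k\<le>K. h (real k + \<beta>)) = (\<Sum>k<K. h (real k + \<beta>)) + h (real K + \<beta>)"
      by (simp add: lessThan_Suc_atMost[symmetric])
    have hK: "h (real K + \<beta>) \<ge> H \<rho> - H (real K + \<beta>)"
    proof -
      have "h (real K + \<beta>) * (\<rho> - (real K + \<beta>)) \<le> h (real K + \<beta>) * 1"
        using K \<beta> hnn[of "real K + \<beta>"] by (intro mult_left_mono) auto
      then show ?thesis using mv[of "real K + \<beta>" \<rho>] K \<beta> by auto
    qed
    have h0: "H \<beta> - H 0 \<le> h 0"
    proof -
      have "h 0 * \<beta> \<le> h 0 * 1" using \<beta> hnn[of 0] \<rho> by (intro mult_left_mono) auto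
      then show ?thesis using mv[of 0 \<beta>] True \<beta> by auto
    qed
    have "0 \<le> h \<beta> * \<beta>" using hnn[of \<beta>] \<beta> True by simp
    then have h1: "H \<beta> \<ge> H 0" using mv[of 0 \<beta>] True \<beta> by auto
    have "0 \<le> h \<rho> * (\<rho> - (real K + \<beta>))" using nonneg K by simp
    then have h2: "H (real K + \<beta>) \<le> H \<rho>" using mv[of "real K + \<beta>" \<rho>] K \<beta> by auto
    have h3: "h \<beta> \<le> h 0" using anti[of 0 \<beta>] \<beta> True by simp
    show ?thesis unfolding set using up[of K] lo[of K] split hK h0 h1 h2 h3 by linarith
  qed
qed

lemma finite_int_interval: "finite {n::int. \<bar>real_of_int n + \<beta>\<bar> \<le> \<rho>}"
proof (rule finite_subset)
  show "{n::int. \<bar>real_of_int n + \<beta>\<bar> \<le> \<rho>} \<subseteq> {\<lfloor>-\<rho>-\<beta>\<rfloor>..\<lceil>\<rho>-\<beta>\<rceil>}"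
    by (auto simp: abs_le_iff) linarith+
qed simp

lemma sum_antimono_line:
  fixes h H :: "real \<Rightarrow> real" and \<beta> \<rho> :: real
  assumes \<rho>: "0 \<le> \<rho>"
    and anti: "\<And>x y. 0 \<le> x \<Longrightarrow> x \<le> y \<Longrightarrow> y \<le> \<rho> \<Longrightarrow> h y \<le> h x"
    and nonneg: "h \<rho> \<ge> 0"
    and cont: "continuous_on {0..\<rho>} H"
    and deriv: "\<And>x. 0 < x \<Longrightarrow> x < \<rho> \<Longrightarrow> (H has_real_derivative h x) (at x)"
  shows "\<bar>(\<Sum>n::int | \<bar>real_of_int n + \<beta>\<bar> \<le> \<rho>. h \<bar>real_of_int n + \<beta>\<bar>) - 2 * (H \<rho> - H 0)\<bar> \<le> 2 * h 0"
proof -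
  define \<delta> where "\<delta> = frac \<beta>"
  have \<delta>: "0 \<le> \<delta>" "\<delta> < 1" by (auto simp: \<delta>_def frac_lt_1)
  have \<beta>: "\<beta> = of_int \<lfloor>\<beta>\<rfloor> + \<delta>" by (simp add: \<delta>_def frac_def)
  define P where "P = {k::nat. real k + \<delta> \<le> \<rho>}"
  define N where "N = {k::nat. real k + (1 - \<delta>) \<le> \<rho>}"
  have fin: "finite {k::nat. real k + d \<le> \<rho>}" if "d \<ge> 0" for d
    by (rule finite_subset[of _ "{..nat \<lceil>\<rho>\<rceil>}"]) (use that in \<open>auto, linarith\<close>)
  have fP: "finite P" and fN: "finite N" unfolding P_def N_def using \<delta> by (auto intro!: fin)
  let ?p = "\<lambda>k::nat. int k - \<lfloor>\<beta>\<rfloor>" and ?q = "\<lambda>k::nat. - int (Suc k) - \<lfloor>\<beta>\<rfloor>"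
  have set: "{n::int. \<bar>real_of_int n + \<beta>\<bar> \<le> \<rho>} = ?p ` P \<union> ?q ` N" (is "?S = _")
  proof (intro equalityI subsetI)
    fix n assume n: "n \<in> ?S"
    show "n \<in> ?p ` P \<union> ?q ` N"
    proof (cases "n + \<lfloor>\<beta>\<rfloor> \<ge> 0")
      case True
      have "n = ?p (nat (n + \<lfloor>\<beta>\<rfloor>))" using True by simp
      moreover have "nat (n + \<lfloor>\<beta>\<rfloor>) \<in> P" using True n \<beta> by (auto simp: P_def)
      ultimately show ?thesis by blast
    next
      case False
      have "n = ?q (nat (- n - \<lfloor>\<beta>\<rfloor> - 1))" using False by simp
      moreover have "nat (- n - \<lfloor>\<beta>\<rfloor> - 1) \<in> N" using False n \<beta> by (auto simp: N_def)
      ultimately show ?thesis by blast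
    qed
  next
    fix n assume "n \<in> ?p ` P \<union> ?q ` N"
    then show "n \<in> ?S" using \<beta> \<delta> by (auto simp: P_def N_def)
  qed
  have disj: "?p ` P \<inter> ?q ` N = {}" by auto
  have ip: "inj_on ?p P" and iq: "inj_on ?q N" by (auto simp: inj_on_def)
  have "(\<Sum>n\<in>?S. h \<bar>real_of_int n + \<beta>\<bar>) = (\<Sum>n\<in>?p ` P. h \<bar>real_of_int n + \<beta>\<bar>) + (\<Sum>n\<in>?q ` N. h \<bar>real_of_int n + \<beta>\<bar>)"
    unfolding set by (intro sum.union_disjoint) (use fP fN disj in auto)
  also have "(\<Sum>n\<in>?p ` P. h \<bar>real_of_int n + \<beta>\<bar>) = (\<Sum>k\<in>P. h (real k + \<delta>))"
    unfolding sum.reindex[OF ip] using \<beta> \<delta> by (intro sum.cong) (auto intro!: arg_cong[of _ _ h])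
  also have "(\<Sum>n\<in>?q ` N. h \<bar>real_of_int n + \<beta>\<bar>) = (\<Sum>k\<in>N. h (real k + (1 - \<delta>)))"
    unfolding sum.reindex[OF iq] using \<beta> \<delta> by (intro sum.cong) (auto intro!: arg_cong[of _ _ h])
  finally have "(\<Sum>n\<in>?S. h \<bar>real_of_int n + \<beta>\<bar>) = (\<Sum>k\<in>P. h (real k + \<delta>)) + (\<Sum>k\<in>N. h (real k + (1 - \<delta>)))" .
  moreover have "\<bar>(\<Sum>k\<in>P. h (real k + \<delta>)) - (H \<rho> - H 0)\<bar> \<le> h 0"
    unfolding P_def by (rule sum_antimono_half_line) (use assms \<delta> in auto)
  moreover have "\<bar>(\<Sum>k\<in>N. h (real k + (1 - \<delta>))) - (H \<rho> - H 0)\<bar> \<le> h 0"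
    unfolding N_def by (rule sum_antimono_half_line) (use assms \<delta> in auto)
  moreover have "\<bar>a - 2 * D\<bar> \<le> 2 * d" if "a = b + c" "\<bar>b - D\<bar> \<le> d" "\<bar>c - D\<bar> \<le> d" for a b c d D :: real
    using that by linarith
  ultimately show ?thesis by blast
qed

lemma card_int_interval:
  assumes "0 \<le> s"
  shows "\<bar>real (card {m::int. \<bar>real_of_int m + \<gamma>\<bar> \<le> s}) - 2 * s\<bar> \<le> 1"
proof -
  have "{m::int. \<bar>real_of_int m + \<gamma>\<bar> \<le> s} = {\<lceil>- s - \<gamma>\<rceil>..\<lfloor>s - \<gamma>\<rfloor>}"
    by (auto simp: abs_le_iff ceiling_le_iff le_floor_iff)
  then have "card {m::int. \<bar>real_of_int m + \<gamma>\<bar> \<le> s} = nat (\<lfloor>s - \<gamma>\<rfloor> - \<lceil>- s - \<gamma>\<rceil> + 1)" by simp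
  then show ?thesis using assms by linarith
qed

lemma semicircle_deriv:
  assumes "0 < x" "x < (1::real)"
  shows "((\<lambda>x. (x * sqrt (1 - x\<^sup>2) + arcsin x) / 2) has_real_derivative sqrt (1 - x\<^sup>2)) (at x)"
proof -
  have p: "1 - x\<^sup>2 > 0" using assms by (simp add: abs_square_less_1)
  have s: "sqrt (1 - x\<^sup>2) > 0" "sqrt (1 - x\<^sup>2) * sqrt (1 - x\<^sup>2) = 1 - x\<^sup>2" using p by auto
  show ?thesis
    apply (rule derivative_eq_intros refl | use assms p in force)+
    using s by (simp add: field_simps power2_eq_square)
qed

lemma ellipse_section:
  fixes A D r x t :: real
  assumes A: "A > 0" and D: "D > 0" and r: "r \<ge> 0"
  defines "\<rho> \<equiv> r * sqrt A / D"
  shows "A * x\<^sup>2 + D\<^sup>2 / A * t\<^sup>2 \<le> r\<^sup>2 \<longleftrightarrow> \<bar>t\<bar> \<le> \<rho> \<and> \<bar>x\<bar> \<le> r / sqrt A * sqrt (1 - (t / \<rho>)\<^sup>2)"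
proof (cases "r = 0")
  case True
  have "A * x\<^sup>2 + D\<^sup>2 / A * t\<^sup>2 \<le> 0 \<longleftrightarrow> A * x\<^sup>2 = 0 \<and> D\<^sup>2 / A * t\<^sup>2 = 0"
    using A D by (smt (verit) divide_nonneg_pos mult_nonneg_nonneg zero_le_power2)
  then show ?thesis using True A D by (auto simp: \<rho>_def)
next
  case False
  then have \<rho>: "\<rho> > 0" using assms by (auto simp: \<rho>_def)
  have sA: "(sqrt A)\<^sup>2 = A" using A by simp
  have q: "D\<^sup>2 / A * t\<^sup>2 = r\<^sup>2 * (t / \<rho>)\<^sup>2"
    unfolding \<rho>_def using False A D by (simp add: power_divide power_mult_distrib field_simps)
  have "A * x\<^sup>2 + D\<^sup>2 / A * t\<^sup>2 \<le> r\<^sup>2 \<longleftrightarrow> x\<^sup>2 \<le> r\<^sup>2 / A * (1 - (t / \<rho>)\<^sup>2)"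
    unfolding q using A by (simp add: field_simps)
  also have "\<dots> \<longleftrightarrow> \<bar>t\<bar> \<le> \<rho> \<and> x\<^sup>2 \<le> r\<^sup>2 / A * (1 - (t / \<rho>)\<^sup>2)"
  proof -
    have "\<bar>t\<bar> \<le> \<rho>" if "x\<^sup>2 \<le> r\<^sup>2 / A * (1 - (t / \<rho>)\<^sup>2)"
    proof -
      have "0 \<le> r\<^sup>2 / A * (1 - (t / \<rho>)\<^sup>2)" using that zero_le_power2 order_trans by blast
      then have "(t / \<rho>)\<^sup>2 \<le> 1" using False A by (simp add: zero_le_mult_iff zero_le_divide_iff)
      then have "\<bar>t / \<rho>\<bar> \<le> 1" by (simp add: abs_square_le_1)
      then show ?thesis using \<rho> by (simp add: abs_divide)
    qed
    then show ?thesis by blast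
  qed
  also have "\<dots> \<longleftrightarrow> \<bar>t\<bar> \<le> \<rho> \<and> \<bar>x\<bar> \<le> r / sqrt A * sqrt (1 - (t / \<rho>)\<^sup>2)"
  proof (rule conj_cong[OF refl])
    assume "\<bar>t\<bar> \<le> \<rho>"
    then have "\<bar>t / \<rho>\<bar> \<le> 1" using \<rho> by (simp add: abs_divide)
    then have t: "0 \<le> 1 - (t / \<rho>)\<^sup>2" by (simp add: abs_square_le_1)
    have e: "(r / sqrt A * sqrt (1 - (t / \<rho>)\<^sup>2))\<^sup>2 = r\<^sup>2 / A * (1 - (t / \<rho>)\<^sup>2)"
      using A t by (simp only: power_mult_distrib power_divide real_sqrt_pow2 sA)
    have n: "0 \<le> r / sqrt A * sqrt (1 - (t / \<rho>)\<^sup>2)" using r A t by (intro mult_nonneg_nonneg) auto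
    show "(x\<^sup>2 \<le> r\<^sup>2 / A * (1 - (t / \<rho>)\<^sup>2)) = (\<bar>x\<bar> \<le> r / sqrt A * sqrt (1 - (t / \<rho>)\<^sup>2))"
      unfolding e[symmetric] abs_le_square_iff[symmetric] using n by (simp only: abs_of_nonneg)
  qed
  finally show ?thesis .
qed

text \<open>
  Cut the ellipse into the horizontal lines of the lattice. Each chord contains its length up to 1 many
  points, and the chord lengths form a semicircle profile, to which the previous comparison applies. The
  offset \<open>\<gamma>\<close> may vary with the line because a chord is only measured by its length; this is how the
  mixed term of a quadratic form is absorbed. The hypothesis \<open>D \<ge> A / 2\<close>, which holds for reduced forms, bounds the
  number of lines by \<open>4 r / sqrt A + 1\<close>.
\<close>

lemma card_ellipse:
  fixes A D \<beta> r :: real and \<gamma> :: "int \<Rightarrow> real"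
  assumes A: "A > 0" and D: "D > 0" and AD: "D \<ge> A / 2" and r: "r \<ge> 0"
  defines "S \<equiv> {(m::int, n::int). A * (of_int m + \<gamma> n)\<^sup>2 + D\<^sup>2 / A * (of_int n + \<beta>)\<^sup>2 \<le> r\<^sup>2}"
  shows "finite S" and "\<bar>real (card S) - pi * r\<^sup>2 / D\<bar> \<le> 8 * r / sqrt A + 1"
proof -
  define \<rho> where "\<rho> = r * sqrt A / D"
  define h where "h = (\<lambda>t. 2 * (r / sqrt A * sqrt (1 - (t / \<rho>)\<^sup>2)))"
  define F where "F = (\<lambda>x::real. (x * sqrt (1 - x\<^sup>2) + arcsin x) / 2)"
  define H where "H = (\<lambda>t. 2 * r / sqrt A * \<rho> * F (t / \<rho>))"
  define N where "N = {n::int. \<bar>of_int n + \<beta>\<bar> \<le> \<rho>}"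
  define M where "M = (\<lambda>n. {m::int. \<bar>of_int m + \<gamma> n\<bar> \<le> h \<bar>of_int n + \<beta>\<bar> / 2})"
  have \<rho>: "\<rho> \<ge> 0" using A D r by (simp add: \<rho>_def)
  have fN: "finite N" and fM: "finite (M n)" for n unfolding N_def M_def by (rule finite_int_interval)+
  have S: "S = (\<lambda>(n, m). (m, n)) ` (SIGMA n:N. M n)"
    unfolding S_def ellipse_section[OF A D r, folded \<rho>_def]
    by (auto simp: N_def M_def h_def power_divide)
  show "finite S" unfolding S using fN fM by auto
  have "card S = card (SIGMA n:N. M n)" unfolding S by (intro card_image) (auto simp: inj_on_def)
  also have "\<dots> = (\<Sum>n\<in>N. card (M n))" using fN fM by (simp add: card_SigmaI)
  finally have cS: "real (card S) = (\<Sum>n\<in>N. real (card (M n)))" by simp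
  have in1: "\<bar>t / \<rho>\<bar> \<le> 1" if "\<bar>t\<bar> \<le> \<rho>" for t
    using that \<rho> by (cases "\<rho> = 0") (auto simp: abs_divide)
  have hnn: "h t \<ge> 0" if "\<bar>t\<bar> \<le> \<rho>" for t
    using in1[OF that] r A unfolding h_def
    by (intro mult_nonneg_nonneg) (auto simp: abs_square_le_1)
  have e1: "\<bar>(\<Sum>n\<in>N. real (card (M n))) - (\<Sum>n\<in>N. h \<bar>of_int n + \<beta>\<bar>)\<bar> \<le> real (card N)"
  proof -
    have "\<bar>\<Sum>n\<in>N. (real (card (M n)) - h \<bar>of_int n + \<beta>\<bar>)\<bar> \<le> (\<Sum>n\<in>N. 1)"
    proof (rule order_trans[OF sum_abs], rule sum_mono)
      fix n assume "n \<in> N"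
      then have "h \<bar>of_int n + \<beta>\<bar> / 2 \<ge> 0" using hnn[of "\<bar>of_int n + \<beta>\<bar>"] by (simp add: N_def)
      from card_int_interval[OF this, of "\<gamma> n"]
      show "\<bar>real (card (M n)) - h \<bar>of_int n + \<beta>\<bar>\<bar> \<le> 1" by (simp add: M_def)
    qed
    then show ?thesis by (simp add: sum_subtractf)
  qed
  have e2: "\<bar>(\<Sum>n\<in>N. h \<bar>of_int n + \<beta>\<bar>) - 2 * (H \<rho> - H 0)\<bar> \<le> 2 * h 0"
    unfolding N_def
  proof (rule sum_antimono_line[OF \<rho>])
    fix x y :: real assume xy: "0 \<le> x" "x \<le> y" "y \<le> \<rho>"
    have "(x / \<rho>)\<^sup>2 \<le> (y / \<rho>)\<^sup>2" using xy \<rho> by (intro power_mono divide_right_mono) auto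
    then show "h y \<le> h x" unfolding h_def using r A by (intro mult_left_mono) auto
  next
    show "0 \<le> h \<rho>" using hnn[of \<rho>] \<rho> by simp
  next
    show "continuous_on {0..\<rho>} H"
    proof (cases "\<rho> = 0")
      case False
      have "\<bar>x / \<rho>\<bar> \<le> 1" if "x \<in> {0..\<rho>}" for x using in1[of x] that by auto
      then have "- 1 \<le> x / \<rho> \<and> x / \<rho> \<le> 1" if "x \<in> {0..\<rho>}" for x using that by (metis abs_le_iff minus_le_iff)
      then show ?thesis unfolding H_def F_def using False
        by (intro continuous_intros) (auto simp: )
    qed auto
  next
    fix x assume x: "0 < x" "x < \<rho>"
    then have "0 < x / \<rho>" "x / \<rho> < 1" by auto
    then have "(F has_real_derivative sqrt (1 - (x / \<rho>)\<^sup>2)) (at (x / \<rho>))"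
      unfolding F_def by (rule semicircle_deriv)
    moreover have "((\<lambda>x. x / \<rho>) has_real_derivative 1 / \<rho>) (at x)"
      using x by (auto intro!: derivative_eq_intros)
    ultimately have "((\<lambda>x. F (x / \<rho>)) has_real_derivative sqrt (1 - (x / \<rho>)\<^sup>2) * (1 / \<rho>)) (at x)"
      by (rule DERIV_chain2)
    from DERIV_cmult[OF this, of "2 * r / sqrt A * \<rho>"]
    show "(H has_real_derivative h x) (at x)" using x by (simp add: H_def h_def field_simps)
  qed
  have HH: "2 * (H \<rho> - H 0) = pi * r\<^sup>2 / D"
  proof (cases "r = 0")
    case False
    then have "\<rho> \<noteq> 0" using A D by (simp add: \<rho>_def)
    then have "2 * (H \<rho> - H 0) = pi * r / sqrt A * \<rho>" by (simp add: H_def F_def field_simps)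
    then show ?thesis using A by (simp add: \<rho>_def power2_eq_square)
  qed (simp add: H_def)
  have e3: "real (card N) \<le> 2 * \<rho> + 1" using card_int_interval[OF \<rho>, of \<beta>] by (simp add: N_def)
  have "A \<le> 2 * D" using AD by simp
  then have "r * A \<le> r * (2 * D)" using r by (rule mult_left_mono)
  then have "\<rho> \<le> 2 * r / sqrt A" using A D
    unfolding \<rho>_def by (simp add: divide_simps mult.assoc mult.commute mult.left_commute)
  moreover have "h 0 = 2 * r / sqrt A" by (simp add: h_def)
  ultimately show "\<bar>real (card S) - pi * r\<^sup>2 / D\<bar> \<le> 8 * r / sqrt A + 1"
    using e1 e2 e3 unfolding cS HH by linarith
qed

section \<open>Integer vectors and bases of orthogonal lattices\<close>

type_synonym ivec = "int \<times> int \<times> int"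

fun idot :: "ivec \<Rightarrow> ivec \<Rightarrow> int" where
  "idot (a1, a2, a3) (b1, b2, b3) = a1 * b1 + a2 * b2 + a3 * b3"

fun icross :: "ivec \<Rightarrow> ivec \<Rightarrow> ivec" where
  "icross (a1, a2, a3) (b1, b2, b3) = (a2 * b3 - a3 * b2, a3 * b1 - a1 * b3, a1 * b2 - a2 * b1)"

fun iscale :: "int \<Rightarrow> ivec \<Rightarrow> ivec" where
  "iscale k (a1, a2, a3) = (k * a1, k * a2, k * a3)"

fun vgcd :: "ivec \<Rightarrow> int" where
  "vgcd (a1, a2, a3) = gcd a1 (gcd a2 a3)"

text \<open>
  Vectors stay integral as long as possible; the Euclidean length is their only real attribute.
\<close>

definition len :: "ivec \<Rightarrow> real" where
  "len u = sqrt (real_of_int (idot u u))"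

lemma idot_commute: "idot u v = idot v u"
  by (cases u; cases v) simp

lemma idot_add_left: "idot (u + v) w = idot u w + idot v w"
  by (cases u; cases v; cases w) (simp add: algebra_simps)

lemma idot_diff_left: "idot (u - v) w = idot u w - idot v w"
  by (cases u; cases v; cases w) (simp add: algebra_simps)

lemma idot_scale_left: "idot (iscale k u) w = k * idot u w"
  by (cases u; cases w) (simp add: algebra_simps)

lemma idot_add_right: "idot w (u + v) = idot w u + idot w v"
  by (metis idot_add_left idot_commute)

lemma idot_diff_right: "idot w (u - v) = idot w u - idot w v"
  by (metis idot_diff_left idot_commute)

lemma idot_scale_right: "idot w (iscale k u) = k * idot w u"
  by (metis idot_scale_left idot_commute)

lemmas idot_linear = idot_add_left idot_diff_left idot_scale_left
  idot_add_right idot_diff_right idot_scale_right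

lemma idot_self_nonneg: "0 \<le> idot u u"
  by (cases u) simp

lemma idot_self_eq_0_iff [simp]: "idot u u = 0 \<longleftrightarrow> u = 0"
proof (cases u)
  case (fields a b c)
  have "a * a \<ge> 0" "b * b \<ge> 0" "c * c \<ge> 0" by simp_all
  then have "a * a + b * b + c * c = 0 \<longleftrightarrow> a * a = 0 \<and> b * b = 0 \<and> c * c = 0" by linarith
  then show ?thesis using fields by (simp add: zero_prod_def)
qed

lemma idot_self_pos: "u \<noteq> 0 \<Longrightarrow> 0 < idot u u"
  using idot_self_nonneg[of u] idot_self_eq_0_iff[of u] by linarith

lemma icross_orthogonal: "idot (icross u v) u = 0" "idot (icross u v) v = 0"
  by (cases u; cases v; simp add: algebra_simps)+

lemma icross_add_right: "icross w (u + v) = icross w u + icross w v"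
  by (cases u; cases v; cases w) (simp add: algebra_simps)

lemma icross_diff_right: "icross w (u - v) = icross w u - icross w v"
  by (cases u; cases v; cases w) (simp add: algebra_simps)

lemma icross_scale_right: "icross w (iscale k u) = iscale k (icross w u)"
  by (cases u; cases w) (simp add: algebra_simps)

lemma icross_self [simp]: "icross u u = 0"
  by (cases u) (simp add: zero_prod_def)

lemma iscale_0_right [simp]: "iscale k 0 = 0"
  by (simp add: zero_prod_def)

lemma iscale_eq_0_iff: "iscale k u = 0 \<longleftrightarrow> k = 0 \<or> u = 0"
  by (cases u) (auto simp: zero_prod_def)

lemma iscale_1 [simp]: "iscale 1 u = u"
  by (cases u) simp

lemma iscale_diff_left: "iscale (j - k) u = iscale j u - iscale k u"
  by (cases u) (simp add: algebra_simps)

lemma iscale_add_right: "iscale k (u + v) = iscale k u + iscale k v"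
  by (cases u; cases v) (simp add: algebra_simps)

lemma iscale_iscale: "iscale j (iscale k u) = iscale (j * k) u"
  by (cases u) simp

lemma iscale_left_cancel: "k \<noteq> 0 \<Longrightarrow> iscale k u = iscale k v \<longleftrightarrow> u = v"
  by (cases u; cases v) simp

lemma icross_icross: "icross u (icross v w) = iscale (idot u w) v - iscale (idot u v) w"
  by (cases u; cases v; cases w) (simp add: algebra_simps)

lemma Lagrange_identity: "idot (icross a b) (icross a b) = idot a a * idot b b - (idot a b)\<^sup>2"
  by (cases a; cases b) (simp add: algebra_simps power2_eq_square)

lemma vgcd_nonneg: "vgcd u \<ge> 0"
  by (cases u) simp

lemma vgcd_eq_0_iff: "vgcd u = 0 \<longleftrightarrow> u = 0"
  by (cases u) (simp add: zero_prod_def)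

lemma vgcd_scale: "vgcd (iscale k u) = \<bar>k\<bar> * vgcd u"
proof (cases u)
  case (fields a b c)
  have "gcd (k * a) (gcd (k * b) (k * c)) = gcd (k * a) (\<bar>k\<bar> * gcd b c)"
    by (simp only: gcd_mult_distrib_int)
  also have "\<dots> = gcd (k * a) (k * gcd b c)" by (cases "k \<ge> 0") auto
  also have "\<dots> = \<bar>k\<bar> * gcd a (gcd b c)" by (simp only: gcd_mult_distrib_int)
  finally show ?thesis using fields by simp
qed

lemma vgcd_bezout: "\<exists>q. idot q u = vgcd u"
proof (cases u)
  case (fields a b c)
  obtain x y where xy: "x * b + y * c = gcd b c" using bezout_int by blast
  obtain z w where "z * a + w * gcd b c = gcd a (gcd b c)" using bezout_int by blast
  then have "idot (z, w * x, w * y) u = vgcd u"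
    using fields by (simp add: xy[symmetric] algebra_simps)
  then show ?thesis by blast
qed

lemma vgcd_decompose:
  assumes "u \<noteq> 0"
  obtains u' where "u = iscale (vgcd u) u'" "vgcd u' = 1"
proof -
  obtain a b c where u: "u = (a, b, c)" by (cases u)
  define g where "g = vgcd u"
  have g: "g > 0" using assms vgcd_nonneg[of u] vgcd_eq_0_iff[of u] unfolding g_def by linarith
  have "g dvd a" "g dvd b" "g dvd c" unfolding g_def u
    by (auto intro: dvd_trans[OF gcd_dvd2])
  then have "u = iscale g (a div g, b div g, c div g)" unfolding u by simp
  moreover from this have "g = g * vgcd (a div g, b div g, c div g)"
    using vgcd_scale[of g "(a div g, b div g, c div g)"] g by (simp add: g_def)
  ultimately show thesis using g that unfolding g_def by (metis mult_cancel_left1 less_irrefl)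
qed

text \<open>
  With \<open>q \<bullet> u = 1\<close>, the identity \<open>q \<times> (u \<times> w) = (q \<bullet> w) u - (q \<bullet> u) w\<close> exhibits the multiple.
\<close>

lemma parallel_imp_multiple:
  assumes "vgcd u = 1" and "icross u w = 0"
  shows "\<exists>k. w = iscale k u"
proof -
  obtain q where q: "idot q u = 1" using vgcd_bezout[of u] assms by auto
  have "iscale (idot q w) u - iscale (idot q u) w = 0"
    using icross_icross[of q u w] assms icross_icross[of q u w]
    by (cases q) (simp add: zero_prod_def)
  then have "w = iscale (idot q w) u" using q by simp
  then show ?thesis by blast
qed

lemma ex_orthogonal:
  "\<exists>w. w \<noteq> 0 \<and> idot w u = 0"
proof (cases u)
  case (fields a b c)
  show ?thesis
  proof (cases "a = 0 \<and> b = 0")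
    case True
    then show ?thesis using fields by (intro exI[of _ "(1, 0, 0)"]) (simp add: zero_prod_def)
  next
    case False
    then show ?thesis using fields by (intro exI[of _ "(b, -a, 0)"]) (auto simp: zero_prod_def)
  qed
qed

lemma ex_nearest_multiple:
  fixes A B :: int
  assumes "A > 0"
  shows "\<exists>k. 2 * \<bar>B - k * A\<bar> \<le> A"
proof -
  define k where "k = (2 * B + A) div (2 * A)"
  have "2 * A * k \<le> 2 * B + A" "2 * B + A < 2 * A * k + 2 * A"
    using assms pos_mod_bound[of "2 * A" "2 * B + A"] pos_mod_sign[of "2 * A" "2 * B + A"]
      mult_div_mod_eq[of "2 * A" "2 * B + A"] unfolding k_def by linarith+
  then have "2 * (B - k * A) \<le> A" "- (2 * (B - k * A)) \<le> A" by (simp_all add: algebra_simps)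
  then have "2 * \<bar>B - k * A\<bar> \<le> A" by (simp add: abs_if)
  then show ?thesis by blast
qed

text \<open>
  A shortest vector \<open>a\<close> of the lattice orthogonal to \<open>u\<close> is primitive, so \<open>p \<bullet> a = 1\<close> for some integer
  vector \<open>p\<close>. Then \<open>b = u \<times> p\<close> satisfies \<open>a \<times> b = (p \<bullet> a) u - (a \<bullet> u) p = u\<close>, and this survives subtracting a
  multiple of \<open>a\<close> from \<open>b\<close> (Gauss reduction). The equation \<open>a \<times> b = u\<close> says at once that \<open>a, b\<close> is a
  basis and that the covolume of the lattice is the length of \<open>u\<close>.
\<close>

lemma reduced_basis:
  assumes u: "vgcd u = 1"
  obtains a b where "vgcd a = 1" "idot a u = 0" "idot b u = 0" "icross a b = u"
    "2 * \<bar>idot a b\<bar> \<le> idot a a" "idot a a \<le> idot b b"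
proof -
  obtain a where a: "a \<noteq> 0" "idot a u = 0"
    and min: "\<And>w. w \<noteq> 0 \<Longrightarrow> idot w u = 0 \<Longrightarrow> nat (idot a a) \<le> nat (idot w w)"
  proof -
    obtain w0 where "w0 \<noteq> 0 \<and> idot w0 u = 0" using ex_orthogonal by blast
    from ex_has_least_nat[of "\<lambda>w. w \<noteq> 0 \<and> idot w u = 0", OF this, of "\<lambda>w. nat (idot w w)"]
    show thesis using that by blast
  qed
  have min': "idot a a \<le> idot w w" if "w \<noteq> 0" "idot w u = 0" for w
    using min[OF that] idot_self_nonneg[of w] by linarith
  obtain a' where a': "a = iscale (vgcd a) a'" "vgcd a' = 1"
    using vgcd_decompose[OF a(1)] by blast
  have g: "vgcd a > 0" using a vgcd_nonneg[of a] vgcd_eq_0_iff[of a] by linarith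
  have "idot a' u = 0" using a(2) g by (subst (asm) a'(1)) (simp add: idot_linear)
  moreover have a'0: "a' \<noteq> 0" using a a' by (metis iscale_0_right)
  ultimately have le: "idot a a \<le> idot a' a'" by (intro min')
  have "vgcd a = 1"
  proof (rule ccontr)
    assume "vgcd a \<noteq> 1"
    then have g2: "vgcd a \<ge> 2" using g by linarith
    have "idot a a = vgcd a * (vgcd a * idot a' a')"
      using arg_cong2[OF a'(1) a'(1), of idot] by (simp add: idot_linear)
    moreover have "2 * idot a' a' \<le> vgcd a * idot a' a'"
      using g2 idot_self_pos[OF a'0] by (intro mult_right_mono) auto
    moreover have "vgcd a * idot a' a' \<le> vgcd a * (vgcd a * idot a' a')"
      using g2 idot_self_pos[OF a'0] by (simp add: mult_le_cancel_left1)
    ultimately show False using le idot_self_pos[OF a'0] by linarith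
  qed
  note prim = this
  then obtain p where p: "idot p a = 1" using vgcd_bezout[of a] by auto
  define b0 where "b0 = icross u p"
  have b0: "icross a b0 = u"
    using icross_icross[of a u p] p a(2) by (simp add: b0_def idot_commute[of a] iscale_eq_0_iff zero_prod_def[symmetric])
  obtain k where k: "2 * \<bar>idot a b0 - k * idot a a\<bar> \<le> idot a a"
    using ex_nearest_multiple[OF idot_self_pos[OF a(1)]] by blast
  define b where "b = b0 - iscale k a"
  have cab: "icross a b = u" by (simp add: b_def icross_diff_right icross_scale_right b0)
  have bu: "idot b u = 0" using icross_orthogonal(2)[of a b] by (simp add: cab idot_commute)
  have "b \<noteq> 0" using cab u vgcd_eq_0_iff[of u]
    by (metis icross_self icross_diff_right diff_self zero_neq_one)
  then have "idot a a \<le> idot b b" using bu by (intro min')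
  moreover have "2 * \<bar>idot a b\<bar> \<le> idot a a" using k by (simp add: b_def idot_linear)
  ultimately show thesis using that prim a cab bu by blast
qed

lemma basis_spans:
  assumes u: "vgcd u = 1" and a: "idot a u = 0" "vgcd a = 1" and ab: "icross a b = u"
    and v: "idot v u = 0"
  shows "\<exists>m n. v = iscale m a + iscale n b"
proof -
  have "icross u (icross a v) = 0"
    unfolding icross_icross using a v by (cases a; cases v) (simp add: idot_commute[of u] zero_prod_def)
  then obtain n where n: "icross a v = iscale n u" using parallel_imp_multiple[OF u] by blast
  have "icross a (v - iscale n b) = 0" by (simp add: icross_diff_right icross_scale_right ab n)
  then obtain m where "v - iscale n b = iscale m a" using parallel_imp_multiple[OF a(2)] by blast
  then show ?thesis by (metis diff_eq_eq)
qed

lemma len_sq: "(len u)\<^sup>2 = real_of_int (idot u u)"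
  by (simp add: len_def idot_self_nonneg)

lemma len_nonneg [simp]: "len u \<ge> 0"
  by (simp add: len_def idot_self_nonneg)

lemma len_le_iff: "r \<ge> 0 \<Longrightarrow> len v \<le> r \<longleftrightarrow> real_of_int (idot v v) \<le> r\<^sup>2"
  using abs_le_square_iff[of "len v" r] by (simp add: len_sq)

lemma len_pos: "u \<noteq> 0 \<Longrightarrow> len u > 0"
  by (simp add: len_def idot_self_pos)

lemma len_scale: "len (iscale k u) = \<bar>real_of_int k\<bar> * len u"
proof -
  have "idot (iscale k u) (iscale k u) = k\<^sup>2 * idot u u" by (simp add: idot_linear power2_eq_square)
  then show ?thesis by (simp add: len_def real_sqrt_mult)
qed

section \<open>Points of a fibre\<close>

lemma complete_square:
  fixes A B C p y :: real
  assumes "A \<noteq> 0"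
  shows "A * (p + B / A * y)\<^sup>2 + (A * C - B\<^sup>2) / A * y\<^sup>2 = A * p\<^sup>2 + 2 * B * p * y + C * y\<^sup>2"
  using assms by (simp add: field_simps power2_eq_square)

text \<open>
  The vectors \<open>v\<close> that can accompany a given \<open>u\<close> in the coordinates \<open>u = x - y\<close>, \<open>v = x + y\<close>.
\<close>

definition fibre :: "ivec \<Rightarrow> real \<Rightarrow> ivec set" where
  "fibre u r = {v. idot v u = 0 \<and> (\<exists>w. v = u + iscale 2 w) \<and> len v \<le> r}"

text \<open>
  For \<open>u = d u'\<close> and \<open>q \<bullet> u' = 1\<close> the vector \<open>v\<^sub>0 = u - d |u'|\<^sup>2 q\<close> is orthogonal to \<open>u\<close>, and it is congruent to \<open>u\<close>
  modulo 2 because \<open>d |u'|\<^sup>2\<close> is even. Hence the fibre is cut out of \<open>v\<^sub>0 + 2 L\<close>, where \<open>L\<close> is the lattice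
  orthogonal to \<open>u'\<close>; in the coordinates of a reduced basis of \<open>L\<close> it consists of the integer
  points of a shifted ellipse of area \<open>pi r\<^sup>2 / (4 |u'|)\<close>.
\<close>

lemma card_fibre:
  fixes r T :: real
  assumes u: "u \<noteq> 0" and ev: "even (idot u u)" and r: "r \<ge> 0" and T: "T > 0"
    and short: "\<And>w. w \<noteq> 0 \<Longrightarrow> idot w u = 0 \<Longrightarrow> T \<le> len w"
  defines "S \<equiv> fibre u r"
  shows "finite S" and "\<bar>real (card S) - pi / 4 * (vgcd u * r\<^sup>2 / len u)\<bar> \<le> 4 * r / T + 1"
proof -
  define d where "d = vgcd u"
  obtain u' where u': "u = iscale d u'" "vgcd u' = 1"
    using vgcd_decompose[OF u] unfolding d_def by metis
  have d: "d > 0" unfolding d_def using u vgcd_nonneg[of u] vgcd_eq_0_iff[of u] by linarith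
  obtain q where q: "idot q u' = 1" using vgcd_bezout[of u'] u' by auto
  have orth: "idot v u = 0 \<longleftrightarrow> idot v u' = 0" for v using d by (simp add: u'(1) idot_linear)
  have "idot u u = d * (d * idot u' u')" by (simp add: u'(1) idot_linear)
  with ev have "even (d * idot u' u')" by auto
  then obtain f where f: "d * idot u' u' = 2 * f" by (elim evenE)
  define v0 where "v0 = u - iscale (2 * f) q"
  have v0: "idot v0 u' = 0"
    using f by (simp add: v0_def idot_linear u'(1) q)
  obtain a b where ab: "vgcd a = 1" "idot a u' = 0" "idot b u' = 0" "icross a b = u'"
    "2 * \<bar>idot a b\<bar> \<le> idot a a" "idot a a \<le> idot b b"
    using reduced_basis[OF u'(2)] by blast
  have a0: "a \<noteq> 0" using ab(1) vgcd_eq_0_iff[of a] by auto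
  have span: "\<exists>m n. v = iscale m a + iscale n b" if "idot v u' = 0" for v
    by (rule basis_spans[OF u'(2) ab(2,1,4) that])
  have u'0: "u' \<noteq> 0" using u'(2) vgcd_eq_0_iff[of u'] by auto
  obtain m0 n0 where mn0: "v0 = iscale m0 a + iscale n0 b" using span[OF v0] by blast
  define \<phi> where "\<phi> = (\<lambda>(m, n). v0 + iscale 2 (iscale m a + iscale n b))"
  have inj: "inj \<phi>"
  proof (rule injI, clarify)
    fix m n m' n' assume "\<phi> (m, n) = \<phi> (m', n')"
    then have eq: "iscale m a + iscale n b = iscale m' a + iscale n' b"
      by (simp add: \<phi>_def iscale_left_cancel)
    then have "icross a (iscale m a + iscale n b) = icross a (iscale m' a + iscale n' b)" by simp
    then have "iscale n u' = iscale n' u'" by (simp add: icross_add_right icross_scale_right ab(4))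
    then have "iscale (n - n') u' = 0" by (simp add: iscale_diff_left)
    then have n: "n = n'" using u'0 by (simp add: iscale_eq_0_iff)
    then have "iscale (m - m') a = 0" using eq by (simp add: iscale_diff_left)
    then show "m = m' \<and> n = n'" using n a0 by (simp add: iscale_eq_0_iff)
  qed
  define A where "A = real_of_int (idot a a)"
  define B where "B = real_of_int (idot a b)"
  define D where "D = len u'"
  define E where "E = {(m::int, n::int). A * (of_int m + (m0 / 2 + B / A * (of_int n + n0 / 2)))\<^sup>2
      + D\<^sup>2 / A * (of_int n + n0 / 2)\<^sup>2 \<le> (r / 2)\<^sup>2}"
  have A: "A > 0" using idot_self_pos[OF a0] by (simp add: A_def)
  have D: "D > 0" using u'0 by (simp add: D_def len_pos)
  have D2: "D\<^sup>2 = A * real_of_int (idot b b) - B\<^sup>2"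
    using Lagrange_identity[of a b] unfolding ab(4) by (simp add: D_def len_sq A_def B_def)
  have AD: "D \<ge> A / 2"
  proof -
    have "real_of_int (2 * \<bar>idot a b\<bar>) \<le> real_of_int (idot a a)" by (simp only: of_int_le_iff ab(5))
    then have "\<bar>B\<bar> \<le> \<bar>A / 2\<bar>" using A by (simp add: A_def B_def)
    then have "B\<^sup>2 \<le> (A / 2)\<^sup>2" by (simp only: abs_le_square_iff)
    then have x1: "B\<^sup>2 \<le> A * A / 4" by (simp only: power_divide) (simp add: power2_eq_square)
    have x2: "A * A \<le> A * real_of_int (idot b b)" using ab(6) A by (intro mult_left_mono) (auto simp: A_def)
    have x3: "0 \<le> A * A" by simp
    have "A * A / 4 \<le> D\<^sup>2" using x1 x2 x3 unfolding D2 by linarith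
    then have "(A / 2)\<^sup>2 \<le> D\<^sup>2" by (simp only: power_divide) (simp add: power2_eq_square)
    then show ?thesis by (rule power2_le_imp_le) (use D in simp)
  qed
  \<comment> \<open>Completing the square in the binary quadratic form of the basis; its determinant is
    \<open>|a \<times> b|\<^sup>2 = |u'|\<^sup>2\<close> by the Lagrange identity.\<close>
  have quad: "real_of_int (idot (\<phi> (m, n)) (\<phi> (m, n))) =
      4 * (A * (of_int m + (m0 / 2 + B / A * (of_int n + n0 / 2)))\<^sup>2 + D\<^sup>2 / A * (of_int n + n0 / 2)\<^sup>2)" for m n
  proof -
    have "idot (\<phi> (m, n)) (\<phi> (m, n)) = (m0 + 2 * m)\<^sup>2 * idot a a
        + 2 * (m0 + 2 * m) * (n0 + 2 * n) * idot a b + (n0 + 2 * n)\<^sup>2 * idot b b"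
      unfolding \<phi>_def mn0 by (simp add: idot_linear idot_commute[of b a] power2_eq_square algebra_simps)
    then have "real_of_int (idot (\<phi> (m, n)) (\<phi> (m, n))) = (of_int m0 + 2 * of_int m)\<^sup>2 * A
        + 2 * (of_int m0 + 2 * of_int m) * (of_int n0 + 2 * of_int n) * B + (of_int n0 + 2 * of_int n)\<^sup>2 * of_int (idot b b)"
      by (simp add: A_def B_def)
    also have "\<dots> = 4 * (A * (of_int m + m0 / 2)\<^sup>2 + 2 * B * (of_int m + m0 / 2) * (of_int n + n0 / 2)
        + of_int (idot b b) * (of_int n + n0 / 2)\<^sup>2)"
      by (simp add: power2_eq_square algebra_simps)
    also have "\<dots> = 4 * (A * ((of_int m + m0 / 2) + B / A * (of_int n + n0 / 2))\<^sup>2 + D\<^sup>2 / A * (of_int n + n0 / 2)\<^sup>2)"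
      using complete_square[of A "of_int m + m0 / 2" B "of_int n + n0 / 2" "of_int (idot b b)"] A
      unfolding D2 by simp
    finally show ?thesis by (simp only: add.assoc)
  qed
  have len_le: "len v \<le> r \<longleftrightarrow> real_of_int (idot v v) \<le> r\<^sup>2" for v
    by (rule len_le_iff[OF r])
  have inE: "p \<in> E \<longleftrightarrow> len (\<phi> p) \<le> r" for p
  proof (cases p)
    case (Pair m n)
    have "X \<le> (r / 2)\<^sup>2 \<longleftrightarrow> 4 * X \<le> r\<^sup>2" for X by (auto simp: power_divide)
    then show ?thesis unfolding Pair len_le quad E_def by simp
  qed
  have S: "S = \<phi> ` E"
  proof (intro equalityI subsetI)
    fix v assume v: "v \<in> S"
    then obtain w where w: "v = u + iscale 2 w" unfolding S_def fibre_def by blast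
    have e: "v - v0 = iscale 2 (w + iscale f q)"
      by (simp add: w v0_def iscale_add_right iscale_iscale)
    have "idot (v - v0) u' = 0" using v v0 by (simp add: S_def fibre_def orth idot_linear)
    then have "idot (w + iscale f q) u' = 0" unfolding e by (simp add: idot_linear)
    from span[OF this] obtain m n where "w + iscale f q = iscale m a + iscale n b" by blast
    then have "v - v0 = iscale 2 (iscale m a + iscale n b)" using e by (simp only:)
    then have "v = \<phi> (m, n)" unfolding \<phi>_def by (simp only: prod.case diff_eq_eq add.commute)
    moreover from this have "(m, n) \<in> E" unfolding inE using v by (simp add: S_def fibre_def)
    ultimately show "v \<in> \<phi> ` E" by blast
  next
    fix v assume "v \<in> \<phi> ` E"
    then obtain m n where mn: "(m, n) \<in> E" "v = \<phi> (m, n)" by auto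
    have shift: "(u - iscale (2 * f) q) + iscale 2 x = u + iscale 2 (x - iscale f q)" for x
      by (cases q; cases u; cases x) (simp add: algebra_simps)
    have "idot v u = 0" unfolding orth mn(2) \<phi>_def using v0 ab by (simp add: idot_linear)
    moreover have "v = u + iscale 2 (iscale m a + iscale n b - iscale f q)"
      unfolding mn(2) \<phi>_def v0_def prod.case by (rule shift)
    moreover have "len v \<le> r" using mn inE by simp
    ultimately show "v \<in> S" unfolding S_def fibre_def by blast
  qed
  have r2: "r / 2 \<ge> 0" using r by simp
  note ell = card_ellipse[OF A D AD r2, of "\<lambda>n. m0 / 2 + B / A * (of_int n + n0 / 2)" "n0 / 2", folded E_def]
  show "finite S" unfolding S using ell(1) by simp
  have cS: "card S = card E" unfolding S by (rule card_image) (use inj in \<open>auto intro: inj_on_subset\<close>)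
  have "T \<le> sqrt A" using short[OF a0] ab(2) by (simp add: orth A_def len_def)
  then have "4 * r / sqrt A \<le> 4 * r / T" using r T A by (intro divide_left_mono mult_pos_pos) auto
  moreover have "pi * (r / 2)\<^sup>2 / D = pi / 4 * (vgcd u * r\<^sup>2 / len u)"
  proof -
    have "len u = d * D" using d len_scale[of d u'] by (simp add: u'(1)[symmetric] D_def)
    then show ?thesis using d by (simp add: d_def[symmetric] power_divide)
  qed
  ultimately show "\<bar>real (card S) - pi / 4 * (vgcd u * r\<^sup>2 / len u)\<bar> \<le> 4 * r / T + 1"
    using ell(2) unfolding cS by simp
qed

section \<open>Lattice points in balls\<close>

fun csum :: "ivec \<Rightarrow> int" where
  "csum (a1, a2, a3) = a1 + a2 + a3"

lemma even_idot_self_iff: "even (idot u u) \<longleftrightarrow> even (csum u)"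
  by (cases u) auto

text \<open>
  The two lattices over which radial sums are needed: \<open>\<int>\<^sup>3\<close>, and its root sublattice \<open>D\<^sub>3\<close> of vectors with even
  coordinate sum. One boolean parameter treats both at once.
\<close>

definition lat :: "bool \<Rightarrow> ivec set" where
  "lat e = {w. e \<longrightarrow> even (csum w)}"

definition dens :: "bool \<Rightarrow> real" where
  "dens e = (if e then 1 / 2 else 1)"

definition lat_ball :: "bool \<Rightarrow> real \<Rightarrow> ivec set" where
  "lat_ball e t = {w \<in> lat e. len w \<le> t}"

text \<open>
  In the case of even sums, \<open>x + y + z = 2 (m + z)\<close> and \<open>x - y = 2 n + z\<close> define a bijection onto a
  shifted square lattice of twice the covolume, again covered by the ellipse count.
\<close>

lemma card_lat_slice:
  fixes s :: real and z :: int and e :: bool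
  assumes s: "s \<ge> 0"
  defines "S \<equiv> {(x::int, y::int). (e \<longrightarrow> even (x + y + z)) \<and> (of_int x)\<^sup>2 + (of_int y)\<^sup>2 \<le> s\<^sup>2}"
  shows "finite S" and "\<bar>real (card S) - dens e * pi * s\<^sup>2\<bar> \<le> 8 * s + 1"
proof -
  have "finite S \<and> \<bar>real (card S) - dens e * pi * s\<^sup>2\<bar> \<le> 8 * s + 1"
  proof (cases e)
    case False
    have eq: "S = {(m::int, n::int). 1 * (of_int m + 0)\<^sup>2 + 1\<^sup>2 / 1 * (of_int n + 0)\<^sup>2 \<le> s\<^sup>2}"
      using False by (simp add: S_def)
    show ?thesis
      unfolding eq using card_ellipse[of 1 1 s "\<lambda>_. 0" 0] s False by (simp add: dens_def)
  next
    case True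
    define E where "E = {(m::int, n::int). 2 * (of_int m + z / 2)\<^sup>2 + 2\<^sup>2 / 2 * (of_int n + z / 2)\<^sup>2 \<le> s\<^sup>2}"
    define f where "f = (\<lambda>(m::int, n::int). (m + n + z, m - n))"
    have inj: "inj_on f E" by (auto simp: f_def inj_on_def)
    have q: "(of_int (m + n + z))\<^sup>2 + (of_int (m - n))\<^sup>2
        = 2 * (of_int m + z / 2)\<^sup>2 + 2\<^sup>2 / 2 * (of_int n + z / 2 :: real)\<^sup>2" for m n :: int
      by (simp add: power2_eq_square field_simps)
    have "S = f ` E"
    proof (intro equalityI subsetI)
      fix p assume "p \<in> S"
      then obtain x y where xy: "p = (x, y)" "even (x + y + z)" "(of_int x)\<^sup>2 + (of_int y)\<^sup>2 \<le> s\<^sup>2"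
        using True unfolding S_def by auto
      then obtain c where c: "x + y + z = 2 * c" by (elim evenE)
      have xe: "x = (c - z) + (c - z - y) + z" and ye: "y = (c - z) - (c - z - y)" using c by auto
      have "(c - z, c - z - y) \<in> E"
        using xy(3) q[of "c - z" "c - z - y", folded xe ye] by (simp add: E_def)
      moreover have "p = f (c - z, c - z - y)" using xy(1) xe by (simp add: f_def)
      ultimately show "p \<in> f ` E" by blast
    next
      fix p assume "p \<in> f ` E"
      then obtain m n where mn: "(m, n) \<in> E" "p = (m + n + z, m - n)" by (auto simp: f_def)
      have "(of_int (m + n + z))\<^sup>2 + (of_int (m - n))\<^sup>2 \<le> s\<^sup>2" unfolding q using mn(1) by (simp add: E_def)
      moreover have "even (m + n + z + (m - n) + z)" by simp
      ultimately show "p \<in> S" unfolding mn(2) S_def by blast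
    qed
    then have "card S = card E" "finite E \<Longrightarrow> finite S" using card_image[OF inj] by simp_all
    moreover have "finite E" "\<bar>real (card E) - pi * s\<^sup>2 / 2\<bar> \<le> 8 * s / sqrt 2 + 1"
      using card_ellipse[of 2 2 s "\<lambda>_. z / 2" "z / 2"] s by (simp_all add: E_def)
    moreover have "8 * s / sqrt 2 \<le> 8 * s / 1" using s by (intro divide_left_mono) auto
    ultimately show ?thesis using True by (simp add: dens_def)
  qed
  then show "finite S" "\<bar>real (card S) - dens e * pi * s\<^sup>2\<bar> \<le> 8 * s + 1" by auto
qed

text \<open>
  Slicing by horizontal planes reduces the ball to discs, whose areas \<open>pi (t\<^sup>2 - z\<^sup>2)\<close> are summed by the same
  comparison with an antiderivative.
\<close>

lemma card_lat_ball:
  assumes t: "t \<ge> 0"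
  shows "finite (lat_ball e t)"
    and "\<bar>real (card (lat_ball e t)) - dens e * (4 / 3 * pi * t ^ 3)\<bar> \<le> 33 * (t + 1)\<^sup>2"
proof -
  define Z where "Z = {z::int. \<bar>of_int z + 0\<bar> \<le> t}"
  define s where "s = (\<lambda>z::int. sqrt (t\<^sup>2 - (of_int z)\<^sup>2))"
  define S where "S = (\<lambda>z::int. {(x::int, y::int). (e \<longrightarrow> even (x + y + z)) \<and> (of_int x)\<^sup>2 + (of_int y)\<^sup>2 \<le> (s z)\<^sup>2})"
  have zt: "(of_int z)\<^sup>2 \<le> t\<^sup>2" if "z \<in> Z" for z
    using that t by (simp add: Z_def abs_le_square_iff[symmetric])
  have s2: "(s z)\<^sup>2 = t\<^sup>2 - (of_int z)\<^sup>2" and s0: "s z \<ge> 0" if "z \<in> Z" for z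
    using zt[OF that] by (simp_all add: s_def)
  have fZ: "finite Z" unfolding Z_def by (rule finite_int_interval)
  have fS: "finite (S z)" if "z \<in> Z" for z unfolding S_def by (rule card_lat_slice(1)[OF s0[OF that]])
  have eq: "lat_ball e t = (\<lambda>(z, x, y). (x, y, z)) ` (SIGMA z:Z. S z)" (is "_ = ?f ` _")
  proof (intro equalityI subsetI)
    fix w assume w: "w \<in> lat_ball e t"
    obtain x y z where xyz: "w = (x, y, z)" by (cases w)
    have le: "(of_int x)\<^sup>2 + (of_int y)\<^sup>2 + (of_int z)\<^sup>2 \<le> t\<^sup>2"
      using w t by (simp add: lat_ball_def len_le_iff xyz power2_eq_square)
    have "(of_int z)\<^sup>2 \<le> t\<^sup>2"
      using le zero_le_power2[of "real_of_int x"] zero_le_power2[of "real_of_int y"] by linarith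
    then have "\<bar>real_of_int z\<bar> \<le> \<bar>t\<bar>" by (simp only: abs_le_square_iff)
    then have z: "z \<in> Z" using t by (simp add: Z_def)
    then have "(x, y) \<in> S z" using le w by (simp add: S_def s2 lat_ball_def lat_def xyz)
    then show "w \<in> ?f ` (SIGMA z:Z. S z)" using z xyz by force
  next
    fix w assume "w \<in> ?f ` (SIGMA z:Z. S z)"
    then obtain x y z where w: "w = (x, y, z)" "z \<in> Z" "(x, y) \<in> S z" by auto
    from w(3) have "(of_int x)\<^sup>2 + (of_int y)\<^sup>2 + (of_int z)\<^sup>2 \<le> t\<^sup>2" "e \<longrightarrow> even (x + y + z)"
      unfolding S_def s2[OF w(2)] by auto
    then show "w \<in> lat_ball e t"
      using t w(1) by (simp add: lat_ball_def lat_def len_le_iff power2_eq_square)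
  qed
  show "finite (lat_ball e t)" unfolding eq using fZ fS by auto
  have "card (lat_ball e t) = card (SIGMA z:Z. S z)"
    unfolding eq by (rule card_image) (auto simp: inj_on_def)
  also have "\<dots> = (\<Sum>z\<in>Z. card (S z))" using fZ fS by simp
  finally have c: "real (card (lat_ball e t)) = (\<Sum>z\<in>Z. real (card (S z)))" by simp
  define h where "h = (\<lambda>x::real. t\<^sup>2 - x\<^sup>2)"
  have e1: "\<bar>(\<Sum>z\<in>Z. real (card (S z))) - dens e * pi * (\<Sum>z\<in>Z. h \<bar>of_int z + 0\<bar>)\<bar> \<le> real (card Z) * (8 * t + 1)"
  proof -
    have "\<bar>\<Sum>z\<in>Z. (real (card (S z)) - dens e * pi * h \<bar>of_int z + 0\<bar>)\<bar> \<le> (\<Sum>z\<in>Z. 8 * t + 1)"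
    proof (rule order_trans[OF sum_abs], rule sum_mono)
      fix z assume z: "z \<in> Z"
      have "s z \<le> t" unfolding s_def using t by (intro real_le_lsqrt) auto
      moreover have "(s z)\<^sup>2 = h \<bar>of_int z + 0\<bar>" using s2[OF z] by (simp add: h_def)
      ultimately show "\<bar>real (card (S z)) - dens e * pi * h \<bar>of_int z + 0\<bar>\<bar> \<le> 8 * t + 1"
        using card_lat_slice(2)[OF s0[OF z], of e z] unfolding S_def by simp
    qed
    then show ?thesis by (simp add: sum_subtractf sum_distrib_left)
  qed
  have e2: "\<bar>(\<Sum>z\<in>Z. h \<bar>of_int z + 0\<bar>) - 2 * ((t\<^sup>2 * t - t ^ 3 / 3) - (t\<^sup>2 * 0 - 0 ^ 3 / 3))\<bar> \<le> 2 * h 0"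
    unfolding Z_def
  proof (rule sum_antimono_line[OF t])
    show "h y \<le> h x" if "0 \<le> x" "x \<le> y" "y \<le> t" for x y
      using that by (simp add: h_def power_mono)
    show "0 \<le> h t" by (simp add: h_def)
    show "continuous_on {0..t} (\<lambda>x. t\<^sup>2 * x - x ^ 3 / 3)" by (intro continuous_intros) auto
    show "((\<lambda>x. t\<^sup>2 * x - x ^ 3 / 3) has_real_derivative h x) (at x)" for x
      by (auto intro!: derivative_eq_intros simp: h_def)
  qed
  have e3: "real (card Z) \<le> 2 * t + 1" using card_int_interval[OF t, of 0] by (simp add: Z_def)
  have d: "0 \<le> dens e" "dens e \<le> 1" by (auto simp: dens_def)
  have dp: "dens e * pi \<le> 4"
    using mult_mono[of "dens e" 1 pi 4] d pi_less_4 by simp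
  have e2': "\<bar>(\<Sum>z\<in>Z. h \<bar>of_int z + 0\<bar>) - 4 / 3 * t ^ 3\<bar> \<le> 2 * t\<^sup>2"
    using e2 by (simp add: h_def power2_eq_square power3_eq_cube)
  have "\<bar>dens e * pi * ((\<Sum>z\<in>Z. h \<bar>of_int z + 0\<bar>) - 4 / 3 * t ^ 3)\<bar> \<le> 4 * (2 * t\<^sup>2)"
    unfolding abs_mult[of "dens e * pi"] using dp d e2' by (intro mult_mono) auto
  then have e4: "\<bar>dens e * pi * (\<Sum>z\<in>Z. h \<bar>of_int z + 0\<bar>) - dens e * (4 / 3 * pi * t ^ 3)\<bar> \<le> 8 * t\<^sup>2"
    by (simp add: algebra_simps)
  have "real (card Z) * (8 * t + 1) \<le> (2 * t + 1) * (8 * t + 1)"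
    using e3 t by (intro mult_right_mono) auto
  moreover have "(2 * t + 1) * (8 * t + 1) + 8 * t\<^sup>2 \<le> 33 * (t + 1)\<^sup>2"
    using t by (simp add: power2_eq_square algebra_simps)
  ultimately show "\<bar>real (card (lat_ball e t)) - dens e * (4 / 3 * pi * t ^ 3)\<bar> \<le> 33 * (t + 1)\<^sup>2"
    using e1 e4 unfolding c by linarith
qed

section \<open>Radial sums\<close>

definition punctured :: "bool \<Rightarrow> real \<Rightarrow> ivec set" where
  "punctured e t = lat_ball e t - {0}"

lemma finite_punctured: "finite (punctured e t)"
proof (cases "t \<ge> 0")
  case False
  then have "\<not> len w \<le> t" for w using len_nonneg[of w] by linarith
  then have "lat_ball e t = {}" by (auto simp: lat_ball_def)
  then show ?thesis by (simp add: punctured_def)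
qed (simp add: punctured_def card_lat_ball)

lemma len_ge_1: "w \<noteq> 0 \<Longrightarrow> len w \<ge> 1"
  using idot_self_pos[of w] by (simp add: len_def)

lemma punctured_iff: "w \<in> punctured e t \<longleftrightarrow> w \<in> lat e \<and> w \<noteq> 0 \<and> len w \<le> t"
  by (auto simp: punctured_def lat_ball_def)

lemma punctured_empty: "t < 1 \<Longrightarrow> punctured e t = {}"
  using len_ge_1 by (force simp: punctured_iff)

lemma card_punctured:
  assumes "t \<ge> 0"
  shows "\<bar>real (card (punctured e t)) - dens e * (4 / 3 * pi * t ^ 3)\<bar> \<le> 33 * (t + 1)\<^sup>2 + 1"
proof -
  have "0 \<in> lat_ball e t" using assms by (simp add: lat_ball_def lat_def len_def zero_prod_def)
  then have "card (lat_ball e t) = Suc (card (punctured e t))"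
    unfolding punctured_def by (rule card.remove[OF card_lat_ball(1)[OF assms]])
  then show ?thesis using card_lat_ball(2)[OF assms, of e] by linarith
qed

text \<open>
  Removing the origin makes this bound true for all \<open>t\<close> down to 0, which gives the dominating functions
  below.
\<close>

lemma card_punctured_le:
  assumes "t \<ge> 0"
  shows "real (card (punctured e t)) \<le> 140 * t ^ 3"
proof (cases "t < 1")
  case False
  then have t: "t \<ge> 1" by simp
  have "dens e * (4 / 3 * pi * t ^ 3) \<le> 1 * (4 / 3 * 4 * t ^ 3)"
    using t pi_less_4 by (intro mult_mono) (auto simp: dens_def)
  moreover have "(t + 1)\<^sup>2 \<le> (2 * t)\<^sup>2" using t by (intro power_mono) auto
  moreover have "(2 * t)\<^sup>2 = 4 * t\<^sup>2" by (simp add: power_mult_distrib)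
  moreover have "t\<^sup>2 \<le> t ^ 3" "1 \<le> t ^ 3" using t by (auto simp: power_increasing one_le_power)
  ultimately show ?thesis using card_punctured[OF assms, of e] by linarith
qed (use assms in \<open>simp add: punctured_empty\<close>)

lemma card_punctured_limit:
  "((\<lambda>t. real (card (punctured e t)) / t ^ 3) \<longlongrightarrow> dens e * (4 / 3 * pi)) at_top"
proof -
  have "((\<lambda>t. real (card (punctured e t)) / t ^ 3 - dens e * (4 / 3 * pi)) \<longlongrightarrow> 0) at_top"
  proof (rule Lim_null_comparison)
    show "\<forall>\<^sub>F t in at_top. norm (real (card (punctured e t)) / t ^ 3 - dens e * (4 / 3 * pi))
        \<le> (33 * (t + 1)\<^sup>2 + 1) / t ^ 3"
      using eventually_gt_at_top[of 0]
    proof eventually_elim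
      case (elim t)
      have "real (card (punctured e t)) / t ^ 3 - dens e * (4 / 3 * pi)
          = (real (card (punctured e t)) - dens e * (4 / 3 * pi * t ^ 3)) / t ^ 3"
        using elim by (simp add: field_simps)
      then show ?case using card_punctured[of t e] elim
        by (simp add: abs_divide divide_right_mono)
    qed
    show "((\<lambda>t. (33 * (t + 1)\<^sup>2 + 1) / t ^ 3) \<longlongrightarrow> (0::real)) at_top" by real_asymp
  qed
  then show ?thesis by (simp add: LIM_zero_iff)
qed

definition radial_sum :: "bool \<Rightarrow> real \<Rightarrow> real" where
  "radial_sum e y = (\<Sum>w\<in>punctured e y. y\<^sup>2 / len w - len w)"

text \<open>
  Since \<open>1 / a - a\<close> is the integral of \<open>1 / s\<^sup>2 + 1\<close> over \<open>[a, 1]\<close>, the radial sum divided by \<open>y\<close> is the integral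
  of this function against the counting function of balls: partial summation in continuous form.
\<close>

definition shell_density :: "bool \<Rightarrow> real \<Rightarrow> real \<Rightarrow> real" where
  "shell_density e y s = (1 / s\<^sup>2 + 1) * real (card (punctured e (y * s))) * indicator {0<..1} s"

lemma radial_sum_integral:
  assumes y: "y > 0"
  shows "has_bochner_integral lborel (shell_density e y) (radial_sum e y / y)"
proof -
  have 1: "has_bochner_integral lborel (\<lambda>s. (1 / s\<^sup>2 + 1) * indicator {len w / y..1} s) (y / len w - len w / y)"
    if w: "w \<in> punctured e y" for w
  proof -
    define a where "a = len w / y"
    have a: "0 < a" "a \<le> 1" using w y by (auto simp: a_def punctured_iff len_pos)
    have "has_bochner_integral lborel (\<lambda>s. (1 / s\<^sup>2 + 1) * indicator {a..1} s) ((1 - 1 / 1) - (a - 1 / a))"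
    proof (rule has_bochner_integral_FTC_Icc_real[OF a(2)])
      fix x :: real assume "a \<le> x"
      then show "((\<lambda>s. s - 1 / s) has_real_derivative 1 / x\<^sup>2 + 1) (at x)"
        using a by (auto intro!: derivative_eq_intros simp: power2_eq_square)
      show "isCont (\<lambda>s. 1 / s\<^sup>2 + 1) x" using a \<open>a \<le> x\<close> by (auto intro!: continuous_intros)
    qed
    then show ?thesis by (simp add: a_def)
  qed
  have "has_bochner_integral lborel
      (\<lambda>s. \<Sum>w\<in>punctured e y. (1 / s\<^sup>2 + 1) * indicator {len w / y..1} s)
      (\<Sum>w\<in>punctured e y. y / len w - len w / y)"
    by (rule has_bochner_integral_sum[OF 1])
  also have "(\<Sum>w\<in>punctured e y. y / len w - len w / y) = radial_sum e y / y"
    unfolding radial_sum_def sum_divide_distrib using y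
    by (intro sum.cong) (auto simp: field_simps power2_eq_square)
  also have "(\<lambda>s. \<Sum>w\<in>punctured e y. (1 / s\<^sup>2 + 1) * indicator {len w / y..1} s) = shell_density e y"
  proof
    fix s :: real
    have eq: "{w \<in> punctured e y. s \<in> {len w / y..1}} = (if 0 < s \<and> s \<le> 1 then punctured e (y * s) else {})"
    proof -
      have "len w \<le> y" if "len w \<le> y * s" "s \<le> 1" for w
        using that y mult_left_le[of s y] by linarith
      moreover have "0 < s" if "len w \<le> y * s" "w \<noteq> 0" for w
        using that y len_pos[of w] by (smt (verit) mult_nonneg_nonpos)
      ultimately show ?thesis using y by (auto simp: punctured_iff pos_divide_le_eq mult.commute)
    qed
    have "(\<Sum>w\<in>punctured e y. (1 / s\<^sup>2 + 1) * indicator {len w / y..1} s)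
        = (1 / s\<^sup>2 + 1) * (\<Sum>w\<in>punctured e y. if s \<in> {len w / y..1} then 1 else 0)"
      by (simp add: sum_distrib_left indicator_def of_bool_def)
    also have "(\<Sum>w\<in>punctured e y. if s \<in> {len w / y..1} then 1 else 0 :: real)
        = real (card {w \<in> punctured e y. s \<in> {len w / y..1}})"
      using finite_punctured[of e y] by (simp add: sum.If_cases Int_def)
    finally show "(\<Sum>w\<in>punctured e y. (1 / s\<^sup>2 + 1) * indicator {len w / y..1} s) = shell_density e y s"
      unfolding eq by (simp add: shell_density_def indicator_def)
  qed
  finally show ?thesis .
qed

lemma shell_density_bound:
  assumes y: "y > 0"
  shows "0 \<le> shell_density e y s / y ^ 3" and "shell_density e y s / y ^ 3 \<le> 280 * indicator {0..1} s"
proof -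
  show "0 \<le> shell_density e y s / y ^ 3" using y by (simp add: shell_density_def)
  show "shell_density e y s / y ^ 3 \<le> 280 * indicator {0..1} s"
  proof (cases "0 < s \<and> s \<le> 1")
    case True
    have "shell_density e y s / y ^ 3 \<le> (1 / s\<^sup>2 + 1) * (140 * (y * s) ^ 3) / y ^ 3"
      unfolding shell_density_def using True y card_punctured_le[of "y * s" e]
      by (intro divide_right_mono) (auto intro!: mult_left_mono)
    also have "\<dots> = 140 * (s + s ^ 3)" using True y by (simp add: field_simps power2_eq_square power3_eq_cube)
    also have "\<dots> \<le> 280" using True power_le_one[of s 3] by simp
    finally show ?thesis using True by simp
  qed (auto simp: shell_density_def)
qed

lemma radial_sum_nonneg: "radial_sum e y \<ge> 0"
proof -
  have "len w \<le> y\<^sup>2 / len w" if "w \<in> punctured e y" for w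
  proof -
    have "len w > 0" "len w \<le> y" using that by (auto simp: punctured_iff len_pos)
    then show ?thesis by (simp add: le_divide_eq power2_eq_square mult_mono)
  qed
  then show ?thesis unfolding radial_sum_def by (intro sum_nonneg) simp
qed

lemma radial_sum_bound:
  assumes y: "y > 0"
  shows "radial_sum e y \<le> 280 * y ^ 4"
proof -
  have i: "has_bochner_integral lborel (\<lambda>s. shell_density e y s / y ^ 3) (radial_sum e y / y / y ^ 3)"
    using y by (intro has_bochner_integral_divide_zero radial_sum_integral)
  have j: "has_bochner_integral lborel (\<lambda>s. 280 * indicator {0..1::real} s) (280 * 1 :: real)"
    using has_bochner_integral_mult_right[OF has_bochner_integral_real_indicator[of "{0..1::real}" lborel], of 280] by simp
  have "radial_sum e y / y / y ^ 3 \<le> 280 * 1"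
    using integral_mono[of lborel "\<lambda>s. shell_density e y s / y ^ 3" "\<lambda>s. 280 * indicator {0..1::real} s"]
      shell_density_bound(2)[OF y, of e] i j
    unfolding has_bochner_integral_iff by metis
  then show ?thesis using y by (simp add: field_simps power4_eq_xxxx power3_eq_cube)
qed

text \<open>
  Dominated convergence: after division by \<open>y\<^sup>3\<close> the shell density tends to a multiple of \<open>s + s\<^sup>3\<close>, and its
  integral over \<open>[0, 1]\<close> is \<open>3 / 4\<close> of that multiple.
\<close>

lemma radial_sum_asymptotics:
  "((\<lambda>y. radial_sum e y / y ^ 4) \<longlongrightarrow> dens e * pi) at_top"
proof -
  define f where "f = (\<lambda>s::real. dens e * (4 / 3 * pi) * (s + s ^ 3) * indicator {0..1} s)"
  define g where "g = (\<lambda>y s. shell_density e y s / y ^ 3)"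
  have f: "has_bochner_integral lborel f (dens e * pi)"
  proof -
    have "has_bochner_integral lborel f
       (dens e * (4 / 3 * pi) * (1\<^sup>2 / 2 + 1 ^ 4 / 4) - dens e * (4 / 3 * pi) * (0\<^sup>2 / 2 + 0 ^ 4 / 4))"
      unfolding f_def
      by (rule has_bochner_integral_FTC_Icc_real) (auto intro!: derivative_eq_intros continuous_intros)
    then show ?thesis by (simp add: field_simps)
  qed
  have mg: "g y \<in> borel_measurable lborel" for y
  proof (cases "y > 0")
    case True
    from radial_sum_integral[OF this, of e]
    have "shell_density e y \<in> borel_measurable lborel"
      using has_bochner_integral_iff borel_measurable_integrable by blast
    then show ?thesis unfolding g_def by (intro borel_measurable_divide) auto
  next
    case False
    have "g y s = 0" for s
    proof (cases "0 < s")
      case True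
      then have "y * s < 1" using False by (smt (verit) mult_nonneg_nonneg mult_minus_left)
      then show ?thesis by (simp add: g_def shell_density_def punctured_empty)
    qed (simp add: g_def shell_density_def)
    then have "g y = (\<lambda>_. 0)" by auto
    then show ?thesis by simp
  qed
  have lim: "((\<lambda>y. g y s) \<longlongrightarrow> f s) at_top" for s
  proof (cases "0 < s \<and> s \<le> 1")
    case True
    have "filterlim (\<lambda>y. y * s) at_top at_top"
      using True by (intro filterlim_at_top_mult_tendsto_pos[OF tendsto_const]) (auto simp: filterlim_ident)
    from filterlim_compose[OF card_punctured_limit this]
    have "((\<lambda>y. (1 / s\<^sup>2 + 1) * s ^ 3 * (real (card (punctured e (y * s))) / (y * s) ^ 3))
        \<longlongrightarrow> (1 / s\<^sup>2 + 1) * s ^ 3 * (dens e * (4 / 3 * pi))) at_top"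
      by (intro tendsto_mult_left)
    moreover have "(1 / s\<^sup>2 + 1) * s ^ 3 * (dens e * (4 / 3 * pi)) = f s"
      using True by (simp add: f_def field_simps power2_eq_square power3_eq_cube)
    moreover have "(1 / s\<^sup>2 + 1) * s ^ 3 * (real (card (punctured e (y * s))) / (y * s) ^ 3) = g y s" for y
      using True by (simp add: g_def shell_density_def power_mult_distrib)
    ultimately show ?thesis by simp
  next
    case False
    then have "f s = 0" "g y s = 0" for y by (cases "s = 0"; force simp: f_def g_def shell_density_def)+
    then show ?thesis by simp
  qed
  have "((\<lambda>y. integral\<^sup>L lborel (g y)) \<longlongrightarrow> integral\<^sup>L lborel f) at_top"
  proof (rule integral_dominated_convergence_at_top)
    show "f \<in> borel_measurable lborel" using f by (auto simp: has_bochner_integral_iff)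
    show "integrable lborel (\<lambda>s. 280 * indicator {0..1::real} s :: real)" by simp
    show "\<forall>\<^sub>F y in at_top. AE s in lborel. norm (g y s) \<le> 280 * indicator {0..1} s"
      using eventually_gt_at_top[of 0]
    proof eventually_elim
      case (elim y)
      have "norm (g y s) \<le> 280 * indicator {0..1} s" for s
        unfolding g_def real_norm_def
        using shell_density_bound[OF elim, of e s] by (simp only: abs_of_nonneg)
      then show ?case by simp
    qed
  qed (use mg lim in auto)
  moreover have "integral\<^sup>L lborel f = dens e * pi" using f by (simp add: has_bochner_integral_iff)
  moreover have "\<forall>\<^sub>F y in at_top. integral\<^sup>L lborel (g y) = radial_sum e y / y ^ 4"
    using eventually_gt_at_top[of 0]
  proof eventually_elim
    case (elim y)
    have "has_bochner_integral lborel (g y) (radial_sum e y / y / y ^ 3)"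
      unfolding g_def using elim by (intro has_bochner_integral_divide_zero radial_sum_integral)
    then show ?case by (simp add: has_bochner_integral_iff power4_eq_xxxx power3_eq_cube mult.assoc)
  qed
  ultimately show ?thesis by (auto intro: Lim_transform_eventually)
qed

section \<open>The main term\<close>

text \<open>
  The product of the Dirichlet series of \<open>totient\<close> and of 1 at the point 3, regrouped by the value of the
  product of the two indices; the inner sums are \<open>\<Sum>\<^sub>d\<^sub>|\<^sub>k totient d = k\<close>. The index set \<open>A\<close> is
  multiplicatively closed together with its divisors so that the identity also covers the odd integers.
\<close>

lemma dirichlet_product_totient:
  fixes A :: "nat set"
  assumes pos: "\<And>n. n \<in> A \<Longrightarrow> n > 0" and mult: "\<And>m n. m * n \<in> A \<longleftrightarrow> m \<in> A \<and> n \<in> A"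
    and X: "((\<lambda>n. real (totient n) / real n ^ 3) has_sum X) A"
    and Y: "((\<lambda>n. 1 / real n ^ 3) has_sum Y) A"
  shows "((\<lambda>n. 1 / real n ^ 2) has_sum X * Y) A"
proof -
  let ?f = "\<lambda>n. real (totient n) / real n ^ 3" and ?g = "\<lambda>n. 1 / real n ^ 3"
  have inner: "((\<lambda>n. ?f m * ?g n) has_sum ?f m * Y) A" for m
    by (rule has_sum_cmult_right[OF Y])
  have outer: "((\<lambda>m. ?f m * Y) has_sum X * Y) A" by (rule has_sum_cmult_left[OF X])
  have prod: "((\<lambda>(m, n). ?f m * ?g n) has_sum X * Y) (A \<times> A)"
  proof (rule has_sum_SigmaI)
    show "((\<lambda>n. case (m, n) of (m, n) \<Rightarrow> ?f m * ?g n) has_sum ?f m * Y) A" for m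
      using inner by simp
    show "(\<lambda>(m, n). ?f m * ?g n) summable_on A \<times> A"
      by (rule summable_on_SigmaI[where g = "\<lambda>m. ?f m * Y"])
         (use inner outer in \<open>auto simp: has_sum_imp_summable\<close>)
  qed (rule outer)
  have bij: "bij_betw (\<lambda>(k, d). (d, k div d)) (SIGMA k:A. {d. d dvd k}) (A \<times> A)"
  proof (rule bij_betw_byWitness[where f' = "\<lambda>(m, n). (m * n, m)"])
    show "(\<lambda>(k, d). (d, k div d)) ` (SIGMA k:A. {d. d dvd k}) \<subseteq> A \<times> A"
    proof clarsimp
      fix k d assume kd: "k \<in> A" "d dvd k"
      then have "d * (k div d) \<in> A" by simp
      then show "d \<in> A \<and> k div d \<in> A" by (simp only: mult)
    qed
  qed (auto simp: mult dest: pos)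
  have "((\<lambda>(k, d). ?f d * ?g (k div d)) has_sum X * Y) (SIGMA k:A. {d. d dvd k})"
    using has_sum_reindex_bij_betw[OF bij, of "\<lambda>(m, n). ?f m * ?g n" "X * Y"] prod
    by (simp add: case_prod_unfold)
  then show ?thesis
  proof (rule has_sum_SigmaD)
    fix k assume k: "k \<in> A"
    have "(\<Sum>d | d dvd k. ?f d * ?g (k div d)) = (\<Sum>d | d dvd k. real (totient d) / real k ^ 3)"
    proof (rule sum.cong[OF refl])
      fix d assume "d \<in> {d. d dvd k}"
      then have "real k = real d * real (k div d)" by (simp flip: of_nat_mult)
      then show "?f d * ?g (k div d) = real (totient d) / real k ^ 3" by (simp add: power_mult_distrib)
    qed
    also have "\<dots> = real (\<Sum>d | d dvd k. totient d) / real k ^ 3" by (simp add: sum_divide_distrib)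
    also have "\<dots> = 1 / real k ^ 2"
      unfolding totient_divisor_sum using pos[OF k] by (simp add: power2_eq_square power3_eq_cube)
    finally show "((\<lambda>d. case (k, d) of (k, d) \<Rightarrow> ?f d * ?g (k div d)) has_sum 1 / real k ^ 2) {d. d dvd k}"
      using pos[OF k] by (intro has_sum_finiteI) auto
  qed
qed

lemma has_sum_odd_part:
  fixes k :: nat and S :: real
  assumes "((\<lambda>n. 1 / real n ^ k) has_sum S) {0<..}"
  shows "((\<lambda>n. 1 / real n ^ k) has_sum (1 - 1 / 2 ^ k) * S) {n. odd n}"
proof -
  have "((\<lambda>n. 1 / 2 ^ k * (1 / real n ^ k)) has_sum 1 / 2 ^ k * S) {0<..}"
    by (rule has_sum_cmult_right[OF assms])
  then have "((\<lambda>n. 1 / real (2 * n) ^ k) has_sum 1 / 2 ^ k * S) {0<..}"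
    by (simp add: power_mult_distrib)
  moreover have "bij_betw (\<lambda>n::nat. 2 * n) {0<..} {n. even n \<and> 0 < n}"
    by (rule bij_betw_byWitness[where f' = "\<lambda>n. n div 2"]) auto
  ultimately have "((\<lambda>n. 1 / real n ^ k) has_sum 1 / 2 ^ k * S) {n. even n \<and> 0 < n}"
    using has_sum_reindex_bij_betw[of "\<lambda>n. 2 * n" "{0<..}" "{n. even n \<and> 0 < n}" "\<lambda>n. 1 / real n ^ k"] by simp
  from has_sum_Diff[OF assms this]
  have "((\<lambda>n. 1 / real n ^ k) has_sum S - 1 / 2 ^ k * S) ({0<..} - {n. even n \<and> 0 < n})" by auto
  moreover have "{0<..} - {n. even n \<and> 0 < n} = {n::nat. odd n}" by (auto intro: odd_pos)
  ultimately show ?thesis by (simp add: algebra_simps)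
qed

lemma has_sum_positive_iff:
  fixes f :: "nat \<Rightarrow> real"
  shows "((\<lambda>n. f (Suc n)) has_sum S) UNIV \<longleftrightarrow> (f has_sum S) {0<..}"
proof (rule has_sum_reindex_bij_betw)
  show "bij_betw Suc UNIV {0<..}"
    by (rule bij_betw_byWitness[where f' = "\<lambda>n. n - 1"]) auto
qed

lemma riemann_zeta_3_has_sum: "((\<lambda>n. 1 / real n ^ 3) has_sum riemann_zeta 3) {0<..}"
proof -
  have "(\<lambda>n. 1 / real (Suc n) ^ 3) sums riemann_zeta 3"
    using riemann_zeta_sums[of 3] by simp
  then have "((\<lambda>n. 1 / real (Suc n) ^ 3) has_sum riemann_zeta 3) UNIV"
    by (rule sums_nonneg_imp_has_sum) simp
  then show ?thesis by (simp only: has_sum_positive_iff[of "\<lambda>n. 1 / real n ^ 3"])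
qed

lemma inverse_squares_has_sum: "((\<lambda>n. 1 / real n ^ 2) has_sum pi\<^sup>2 / 6) {0<..}"
proof -
  have "(\<lambda>n. 1 / real (Suc n) ^ 2) sums (pi\<^sup>2 / 6)"
    using inverse_squares_sums by (simp add: add.commute)
  then have "((\<lambda>n. 1 / real (Suc n) ^ 2) has_sum pi\<^sup>2 / 6) UNIV"
    by (rule sums_nonneg_imp_has_sum) simp
  then show ?thesis by (simp only: has_sum_positive_iff[of "\<lambda>n. 1 / real n ^ 2"])
qed

text \<open>
  Even \<open>n\<close> have weight 1 and odd \<open>n\<close> weight \<open>1 / 2\<close>, so the value is \<open>X - W / 2\<close>, where \<open>X = \<zeta>(2) / \<zeta>(3)\<close> is the
  whole series and \<open>W = (3 / 4) \<zeta>(2) / ((7 / 8) \<zeta>(3)) = (6 / 7) X\<close> its odd part.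
\<close>

lemma totient_dens_sums:
  "(\<lambda>n. real (totient (Suc n)) * dens (odd (Suc n)) / real (Suc n) ^ 3) sums (2 * pi\<^sup>2 / (21 * riemann_zeta 3))"
proof -
  let ?f = "\<lambda>n. real (totient n) / real n ^ 3"
  have sq: "(\<lambda>n. 1 / real n ^ 2) summable_on {0<..}" using inverse_squares_has_sum has_sum_imp_summable by blast
  have "?f summable_on {0<..}"
  proof (rule summable_on_comparison_test[OF sq])
    fix n :: nat assume n: "n \<in> {0<..}"
    have "?f n \<le> real n / real n ^ 3" by (intro divide_right_mono) (auto simp: totient_le)
    then show "?f n \<le> 1 / real n ^ 2" using n by (simp add: power2_eq_square power3_eq_cube)
  qed auto
  then obtain X where X: "(?f has_sum X) {0<..}" by (auto simp: summable_on_def)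
  have "?f summable_on {n. odd n}"
    by (rule summable_on_subset_banach[OF has_sum_imp_summable[OF X]]) (auto intro: odd_pos)
  then obtain W where W: "(?f has_sum W) {n. odd n}" by (auto simp: summable_on_def)
  define \<zeta> where "\<zeta> = riemann_zeta 3"
  have \<zeta>: "((\<lambda>n. 1 / real n ^ 3) has_sum \<zeta>) {0<..}" unfolding \<zeta>_def by (rule riemann_zeta_3_has_sum)
  have "((\<lambda>n. 1 / real n ^ 2) has_sum X * \<zeta>) {0<..}"
    by (rule dirichlet_product_totient[OF _ _ X \<zeta>]) auto
  then have 1: "X * \<zeta> = pi\<^sup>2 / 6" using inverse_squares_has_sum has_sum_unique by blast
  have "((\<lambda>n. 1 / real n ^ 2) has_sum W * ((1 - 1 / 2 ^ 3) * \<zeta>)) {n. odd n}"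
    by (rule dirichlet_product_totient[OF _ _ W has_sum_odd_part[OF \<zeta>]]) (auto intro: odd_pos)
  then have 2: "W * ((1 - 1 / 2 ^ 3) * \<zeta>) = (1 - 1 / 2\<^sup>2) * (pi\<^sup>2 / 6)"
    using has_sum_odd_part[OF inverse_squares_has_sum] has_sum_unique by blast
  have \<zeta>0: "\<zeta> \<noteq> 0" using 1 by auto
  have E: "(?f has_sum X - W) ({0<..} - {n. odd n})"
    by (rule has_sum_Diff[OF X W]) (auto intro: odd_pos)
  have a: "((\<lambda>n. ?f n * dens (odd n)) has_sum (X - W) * 1) ({0<..} - {n. odd n})"
    by (subst has_sum_cong[where g = "\<lambda>n. ?f n * 1"]) (use E in \<open>auto simp: dens_def\<close>)
  have b: "((\<lambda>n. ?f n * dens (odd n)) has_sum W * (1 / 2)) {n. odd n}"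
    using has_sum_cmult_left[OF W, of "1 / 2"]
    by (subst has_sum_cong[where g = "\<lambda>n. ?f n * (1 / 2)"]) (auto simp: dens_def)
  have "((\<lambda>n. ?f n * dens (odd n)) has_sum (X - W) * 1 + W * (1 / 2)) (({0<..} - {n. odd n}) \<union> {n. odd n})"
    by (rule has_sum_Un_disjoint[OF a b]) auto
  moreover have "({0<..} - {n. odd n}) \<union> {n. odd n} = ({0<..} :: nat set)" by (auto intro: odd_pos)
  moreover have "(X - W) * 1 + W * (1 / 2) = 2 * pi\<^sup>2 / (21 * \<zeta>)"
  proof -
    have "X = pi\<^sup>2 / 6 / \<zeta>" "W = pi\<^sup>2 / 7 / \<zeta>" using 1 2 \<zeta>0 by (auto simp: field_simps)
    then show ?thesis by (simp add: field_simps)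
  qed
  ultimately have "((\<lambda>n. ?f n * dens (odd n)) has_sum 2 * pi\<^sup>2 / (21 * \<zeta>)) {0<..}" by simp
  then have "((\<lambda>n. ?f (Suc n) * dens (odd (Suc n))) has_sum 2 * pi\<^sup>2 / (21 * \<zeta>)) UNIV"
    by (simp only: has_sum_positive_iff[of "\<lambda>n. ?f n * dens (odd n)"])
  then have "(\<lambda>n. ?f (Suc n) * dens (odd (Suc n))) sums (2 * pi\<^sup>2 / (21 * \<zeta>))"
    by (rule has_sum_imp_sums)
  then show ?thesis by (simp add: \<zeta>_def)
qed

lemma vgcd_le_len: "u \<noteq> 0 \<Longrightarrow> real_of_int (vgcd u) \<le> len u"
proof -
  assume u: "u \<noteq> 0"
  obtain u' where u': "u = iscale (vgcd u) u'" using vgcd_decompose[OF u] by blast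
  then have "u' \<noteq> 0" using u by (metis iscale_0_right)
  then have "real_of_int (vgcd u) * 1 \<le> real_of_int (vgcd u) * len u'"
    using vgcd_nonneg[of u] by (intro mult_left_mono len_ge_1) auto
  also have "\<dots> = len u" using len_scale[of "vgcd u" u'] vgcd_nonneg[of u] u' by simp
  finally show ?thesis by simp
qed

text \<open>
  Up to the factor \<open>pi / 4\<close>, the sum of area over covolume for all fibres.
\<close>

definition main_term :: "real \<Rightarrow> real" where
  "main_term R = (\<Sum>u\<in>punctured True R. vgcd u * (R\<^sup>2 - (len u)\<^sup>2) / len u)"

lemma dvd_vgcd_iff: "int n dvd vgcd u \<longleftrightarrow> (\<exists>w. u = iscale (int n) w)"
proof
  assume n: "int n dvd vgcd u"
  obtain a b c where u: "u = (a, b, c)" by (cases u)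
  have "int n dvd a" "int n dvd b" "int n dvd c" using n unfolding u by auto
  then have "u = iscale (int n) (a div int n, b div int n, c div int n)" unfolding u by simp
  then show "\<exists>w. u = iscale (int n) w" by blast
qed (auto simp: vgcd_scale)

text \<open>
  If \<open>n\<close> is even, every vector \<open>n w\<close> has even coordinate sum and \<open>w\<close> is arbitrary; if \<open>n\<close> is odd, the parity
  condition passes to \<open>w\<close>.
\<close>

lemma sum_multiples:
  assumes n: "n > 0"
  shows "(\<Sum>u\<in>{u \<in> punctured True R. int n dvd vgcd u}. (R\<^sup>2 - (len u)\<^sup>2) / len u)
    = real n * radial_sum (odd n) (R / real n)"
proof -
  have inj: "inj_on (iscale (int n)) (punctured (odd n) (R / real n))"
    using n by (auto simp: inj_on_def iscale_left_cancel)
  have cs: "csum (iscale (int n) w) = int n * csum w" for w by (cases w) (simp add: algebra_simps)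
  have mem: "iscale (int n) w \<in> punctured True R \<longleftrightarrow> w \<in> punctured (odd n) (R / real n)" for w
    using n unfolding punctured_iff lat_def mem_Collect_eq cs len_scale iscale_eq_0_iff
    by (simp add: pos_le_divide_eq mult.commute) blast
  have eq: "{u \<in> punctured True R. int n dvd vgcd u} = iscale (int n) ` punctured (odd n) (R / real n)"
  proof (intro equalityI subsetI)
    fix u assume "u \<in> {u \<in> punctured True R. int n dvd vgcd u}"
    then have u: "\<exists>w. u = iscale (int n) w" "u \<in> punctured True R" unfolding dvd_vgcd_iff by blast+
    then obtain w where w: "u = iscale (int n) w" by blast
    then show "u \<in> iscale (int n) ` punctured (odd n) (R / real n)"
      using u(2) mem w by blast
  next
    fix u assume "u \<in> iscale (int n) ` punctured (odd n) (R / real n)"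
    then obtain w where "w \<in> punctured (odd n) (R / real n)" "u = iscale (int n) w" by blast
    then show "u \<in> {u \<in> punctured True R. int n dvd vgcd u}"
      unfolding mem_Collect_eq dvd_vgcd_iff using mem by blast
  qed
  show ?thesis unfolding eq sum.reindex[OF inj] radial_sum_def sum_distrib_left
  proof (rule sum.cong[OF refl])
    fix w assume "w \<in> punctured (odd n) (R / real n)"
    then have "len w > 0" by (auto simp: punctured_iff len_pos)
    then show "((\<lambda>u. (R\<^sup>2 - (len u)\<^sup>2) / len u) \<circ> iscale (int n)) w = real n * ((R / real n)\<^sup>2 / len w - len w)"
      using n by (simp add: len_scale field_simps power2_eq_square)
  qed
qed

text \<open>
  Expanding the gcd as a sum of totients over its divisors replaces the restriction to primitive
  vectors, and with it any Moebius inversion, by sums over full lattices.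
\<close>

lemma main_term_eq:
  assumes K: "real K \<ge> R"
  shows "main_term R = (\<Sum>n\<in>{1..K}. real (totient n) * (real n * radial_sum (odd n) (R / real n)))"
proof -
  let ?f = "\<lambda>u. (R\<^sup>2 - (len u)\<^sup>2) / len u"
  have c: "real_of_int (vgcd u) = (\<Sum>n\<in>{1..K}. if int n dvd vgcd u then real (totient n) else 0)"
    if u: "u \<in> punctured True R" for u
  proof -
    define c where "c = nat (vgcd u)"
    have u0: "u \<noteq> 0" "len u \<le> R" using u by (auto simp: punctured_iff)
    then have "vgcd u > 0" using vgcd_nonneg[of u] vgcd_eq_0_iff[of u] by linarith
    then have c: "vgcd u = int c" "c > 0" by (auto simp: c_def)
    have "real c \<le> real K" using vgcd_le_len[OF u0(1)] u0 K c by simp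
    then have cK: "c \<le> K" by simp
    have "real c = (\<Sum>n | n dvd c. real (totient n))"
      using totient_divisor_sum[of c] by (metis of_nat_sum)
    also have "{n. n dvd c} = {n \<in> {1..K}. n dvd c}"
    proof (intro Collect_cong iffI conjI)
      fix n assume n: "n dvd c"
      then have "0 < n" "n \<le> c" using c(2) dvd_pos_nat dvd_imp_le by blast+
      then show "n \<in> {1..K}" using cK by simp
    qed auto
    also have "(\<Sum>n\<in>{n \<in> {1..K}. n dvd c}. real (totient n))
        = (\<Sum>n\<in>{1..K}. if n dvd c then real (totient n) else 0)"
      by (rule sum.inter_filter) simp
    finally show ?thesis using c(1) by simp
  qed
  have "main_term R = (\<Sum>u\<in>punctured True R. \<Sum>n\<in>{1..K}. if int n dvd vgcd u then real (totient n) * ?f u else 0)"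
    unfolding main_term_def
  proof (rule sum.cong[OF refl])
    fix u assume u: "u \<in> punctured True R"
    have "vgcd u * (R\<^sup>2 - (len u)\<^sup>2) / len u = vgcd u * ?f u" by simp
    also have "\<dots> = (\<Sum>n\<in>{1..K}. (if int n dvd vgcd u then real (totient n) else 0) * ?f u)"
      unfolding c[OF u] by (rule sum_distrib_right)
    also have "\<dots> = (\<Sum>n\<in>{1..K}. if int n dvd vgcd u then real (totient n) * ?f u else 0)"
      by (intro sum.cong) auto
    finally show "vgcd u * (R\<^sup>2 - (len u)\<^sup>2) / len u
        = (\<Sum>n\<in>{1..K}. if int n dvd vgcd u then real (totient n) * ?f u else 0)" .
  qed
  also have "\<dots> = (\<Sum>n\<in>{1..K}. \<Sum>u\<in>punctured True R. if int n dvd vgcd u then real (totient n) * ?f u else 0)"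
    by (rule sum.swap)
  also have "\<dots> = (\<Sum>n\<in>{1..K}. real (totient n) * (real n * radial_sum (odd n) (R / real n)))"
  proof (rule sum.cong[OF refl])
    fix n assume "n \<in> {1..K}"
    then have n: "n > 0" by simp
    show "(\<Sum>u\<in>punctured True R. if int n dvd vgcd u then real (totient n) * ?f u else 0)
        = real (totient n) * (real n * radial_sum (odd n) (R / real n))"
      unfolding sum_multiples[OF n, symmetric] sum_distrib_left
      by (rule sum.inter_filter[OF finite_punctured, symmetric])
  qed
  finally show ?thesis .
qed

lemma main_term_asymptotics:
  "((\<lambda>R. main_term R / R ^ 4) \<longlongrightarrow> 2 * pi ^ 3 / (21 * riemann_zeta 3)) at_top"
proof -
  define a where "a = (\<lambda>n R. real (totient (Suc n)) * (real (Suc n) * radial_sum (odd (Suc n)) (R / real (Suc n))) / R ^ 4)"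
  define b where "b = (\<lambda>n. real (totient (Suc n)) * dens (odd (Suc n)) / real (Suc n) ^ 3 * pi)"
  have a_eq: "a n R = real (totient (Suc n)) / real (Suc n) ^ 3
      * (radial_sum (odd (Suc n)) (R / real (Suc n)) / (R / real (Suc n)) ^ 4)" for n R
    by (simp add: a_def power_divide field_simps power4_eq_xxxx power3_eq_cube del: of_nat_Suc)
  have lim: "((\<lambda>R. a n R) \<longlongrightarrow> b n) at_top" for n
  proof -
    have "filterlim (\<lambda>R. R / real (Suc n)) at_top at_top" by real_asymp
    from filterlim_compose[OF radial_sum_asymptotics[of "odd (Suc n)"] this]
    have "((\<lambda>R. real (totient (Suc n)) / real (Suc n) ^ 3
      * (radial_sum (odd (Suc n)) (R / real (Suc n)) / (R / real (Suc n)) ^ 4)) \<longlongrightarrow>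
      real (totient (Suc n)) / real (Suc n) ^ 3 * (dens (odd (Suc n)) * pi)) at_top"
      by (intro tendsto_mult_left)
    then show ?thesis unfolding a_eq b_def by (simp only: times_divide_eq_left mult.assoc)
  qed
  \<comment> \<open>The bound is uniform in \<open>R\<close>, since the radial sums are \<open>O(y\<^sup>4)\<close> for all positive \<open>y\<close>.\<close>
  have bound: "norm (a n R) \<le> 280 * (1 / real (Suc n) ^ 2)" if R: "R > 0" for n R
  proof -
    define y where "y = R / real (Suc n)"
    have y: "y > 0" using R by (simp add: y_def)
    have 1: "0 \<le> radial_sum (odd (Suc n)) y / y ^ 4" "radial_sum (odd (Suc n)) y / y ^ 4 \<le> 280"
      using radial_sum_nonneg radial_sum_bound[OF y, of "odd (Suc n)"] y by (auto simp: divide_le_eq)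
    have "real (totient (Suc n)) \<le> real (Suc n)" by (simp only: of_nat_le_iff totient_le)
    then have "real (totient (Suc n)) / real (Suc n) ^ 3 \<le> real (Suc n) / real (Suc n) ^ 3"
      by (intro divide_right_mono) auto
    also have "\<dots> = 1 / real (Suc n) ^ 2" by (simp add: power2_eq_square power3_eq_cube del: of_nat_Suc)
    finally have 2: "real (totient (Suc n)) / real (Suc n) ^ 3 \<le> 1 / real (Suc n) ^ 2" .
    have "a n R \<le> 1 / real (Suc n) ^ 2 * 280" unfolding a_eq y_def[symmetric]
      by (rule mult_mono) (use 1 2 in auto)
    moreover have "a n R \<ge> 0" unfolding a_eq y_def[symmetric]
      by (rule mult_nonneg_nonneg) (use 1 in auto)
    ultimately show ?thesis by simp
  qed
  have sm: "summable (\<lambda>n. 280 * (1 / real (Suc n) ^ 2))"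
    using inverse_squares_sums by (intro summable_mult) (auto simp: sums_iff add.commute)
  have "((\<lambda>R. suminf (\<lambda>n. a n R)) \<longlongrightarrow> suminf b) at_top"
  proof (rule tannerys_theorem[THEN conjunct2, THEN conjunct2, OF lim _ sm])
    have "\<forall>\<^sub>F (n, R) in sequentially \<times>\<^sub>F at_top. (R::real) > 0"
      unfolding case_prod_unfold by (rule eventually_compose_filterlim[OF eventually_gt_at_top filterlim_snd])
    then show "\<forall>\<^sub>F (n, R) in sequentially \<times>\<^sub>F at_top. norm (a n R) \<le> 280 * (1 / real (Suc n) ^ 2)"
      by eventually_elim (use bound in auto)
  qed simp
  moreover have "suminf b = 2 * pi ^ 3 / (21 * riemann_zeta 3)"
  proof -
    have "b sums (2 * pi\<^sup>2 / (21 * riemann_zeta 3) * pi)"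
      unfolding b_def by (rule sums_mult2[OF totient_dens_sums])
    then show ?thesis by (simp add: sums_iff power2_eq_square power3_eq_cube)
  qed
  moreover have "suminf (\<lambda>n. a n R) = main_term R / R ^ 4" for R
  proof -
    define K where "K = nat \<lceil>R\<rceil>"
    have K: "real K \<ge> R" unfolding K_def by (rule real_nat_ceiling_ge)
    have "suminf (\<lambda>n. a n R) = (\<Sum>n<K. a n R)"
    proof (rule suminf_finite)
      fix n assume "n \<notin> {..<K}"
      then have "R / real (Suc n) < 1" using K by (simp add: divide_less_eq)
      then show "a n R = 0" by (simp add: a_def radial_sum_def punctured_empty)
    qed simp
    also have "\<dots> = (\<Sum>n\<in>{1..K}. real (totient n) * (real n * radial_sum (odd n) (R / real n)) / R ^ 4)"
      unfolding a_def by (rule sum.reindex_bij_witness[of _ "\<lambda>n. n - 1" Suc]) auto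
    also have "\<dots> = main_term R / R ^ 4" by (simp only: main_term_eq[OF K] sum_divide_distrib)
    finally show ?thesis .
  qed
  ultimately show ?thesis by simp
qed

section \<open>Pairs of representations and the error term\<close>

lemma r3_eq_card: "r3 n = card {x. idot x x = int n}" "finite {x. idot x x = int n}"
proof -
  have eq: "{x. idot x x = int n} = {(x1, x2, x3). x1\<^sup>2 + x2\<^sup>2 + x3\<^sup>2 = int n}"
    by (auto simp: power2_eq_square)
  show "r3 n = card {x. idot x x = int n}" "finite {x. idot x x = int n}"
    unfolding eq r3_def using finite_three_squares_reps by auto
qed

lemma fibre_zero_subset: "fibre 0 R - {0} \<subseteq> punctured False R"
  by (auto simp: fibre_def punctured_iff lat_def)

text \<open>
  From \<open>v \<equiv> u\<close> modulo 2 and \<open>v \<bullet> u = 0\<close> follows \<open>u \<bullet> u \<equiv> 0\<close> modulo 2.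
\<close>

lemma fibre_parity:
  assumes "v \<in> fibre u r"
  shows "even (csum u)"
proof -
  obtain w where w: "v = u + iscale 2 w" and "idot v u = 0" using assms by (auto simp: fibre_def)
  then have "idot u u = 2 * (- idot w u)" by (simp add: idot_linear)
  then have "even (idot u u)" by simp
  then show ?thesis by (simp only: even_idot_self_iff)
qed

lemma pair_eq_0_iff: "(u, v) = (0 :: ivec \<times> ivec) \<longleftrightarrow> u = 0 \<and> v = 0"
  by (simp add: zero_prod_def)

definition orthogonal_pairs :: "real \<Rightarrow> (ivec \<times> ivec) set" where
  "orthogonal_pairs R = {(u, v). idot v u = 0 \<and> (\<exists>w. v = u + iscale 2 w) \<and> (u, v) \<noteq> 0
     \<and> (len u)\<^sup>2 + (len v)\<^sup>2 \<le> R\<^sup>2}"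

text \<open>
  The change of variables \<open>(x, y) \<mapsto> (x - y, x + y)\<close>. The bound is \<open>4 n \<le> R\<^sup>2\<close> because
  \<open>|x - y|\<^sup>2 + |x + y|\<^sup>2 = 2 |x|\<^sup>2 + 2 |y|\<^sup>2 = 4 n\<close>.
\<close>

lemma sum_r3_squared_eq_card_orthogonal_pairs:
  "(\<Sum>n | 0 < n \<and> 4 * real n \<le> R\<^sup>2. (r3 n)\<^sup>2) = card (orthogonal_pairs R)"
proof -
  define N where "N = {n::nat. 0 < n \<and> 4 * real n \<le> R\<^sup>2}"
  define X where "X = (\<lambda>n. {x. idot x x = int n})"
  define f where "f = (\<lambda>(n::nat, x::ivec, y::ivec). (x - y, x + y))"
  have fN: "finite N"
    by (rule finite_subset[of _ "{..nat \<lceil>R\<^sup>2\<rceil>}"]) (auto simp: N_def, linarith)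
  have "(\<Sum>n\<in>N. (r3 n)\<^sup>2) = (\<Sum>n\<in>N. card (X n \<times> X n))"
    unfolding X_def r3_eq_card(1) by (simp add: power2_eq_square card_cartesian_product)
  also have "\<dots> = card (SIGMA n:N. X n \<times> X n)"
    using fN r3_eq_card(2) unfolding X_def by (intro card_SigmaI[symmetric]) auto
  also have "\<dots> = card (f ` (SIGMA n:N. X n \<times> X n))"
  proof (rule card_image[symmetric], rule inj_onI)
    fix p q assume p: "p \<in> (SIGMA n:N. X n \<times> X n)" and q: "q \<in> (SIGMA n:N. X n \<times> X n)" and eq: "f p = f q"
    obtain n x y where p': "p = (n, x, y)" by (cases p)
    obtain m z w where q': "q = (m, z, w)" by (cases q)
    have "x = z \<and> y = w" using eq unfolding p' q' f_def by (cases x; cases y; cases z; cases w) auto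
    moreover from this have "int n = int m" using p q by (simp add: p' q' X_def)
    ultimately show "p = q" by (simp add: p' q')
  qed
  also have "f ` (SIGMA n:N. X n \<times> X n) = orthogonal_pairs R"
  proof (intro equalityI subsetI)
    fix p assume "p \<in> f ` (SIGMA n:N. X n \<times> X n)"
    then obtain n x y where p: "p = (x - y, x + y)" and n: "0 < n" "4 * real n \<le> R\<^sup>2"
      and x: "idot x x = int n" and y: "idot y y = int n"
      by (auto simp: f_def N_def X_def)
    have 1: "idot (x + y) (x - y) = 0" by (simp add: idot_linear x y idot_commute[of y x])
    have 2: "x + y = (x - y) + iscale 2 y" by (cases x; cases y) simp
    have "idot (x - y) (x - y) + idot (x + y) (x + y) = 4 * int n"
      by (simp add: idot_linear x y idot_commute[of y x])
    then have 3: "(len (x - y))\<^sup>2 + (len (x + y))\<^sup>2 = 4 * real n"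
      unfolding len_sq by (metis of_int_add of_int_mult of_int_numeral of_int_of_nat_eq)
    have 4: "(x - y, x + y) \<noteq> 0" using 3 n(1) by (auto simp: zero_prod_def len_def)
    show "p \<in> orthogonal_pairs R"
      unfolding p orthogonal_pairs_def mem_Collect_eq prod.case using 1 2 4 n(2) unfolding 3[symmetric] by blast
  next
    fix p assume "p \<in> orthogonal_pairs R"
    then obtain u v w where p: "p = (u, v)" and uv: "idot v u = 0" and v: "v = u + iscale 2 w"
      and nz: "(u, v) \<noteq> 0" and le: "(len u)\<^sup>2 + (len v)\<^sup>2 \<le> R\<^sup>2"
      by (auto simp: orthogonal_pairs_def)
    define n where "n = nat (idot w w)"
    have n: "idot w w = int n" using idot_self_nonneg[of w] by (simp add: n_def)
    have a: "idot u u + 2 * idot w u = 0" using uv by (simp add: v idot_linear)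
    have b: "idot (u + w) (u + w) = int n"
      using a by (simp add: idot_linear idot_commute[of u w] n)
    have "idot u u + idot v v = 4 * int n"
      using a by (simp add: v idot_linear idot_commute[of u w] n)
    then have c: "(len u)\<^sup>2 + (len v)\<^sup>2 = 4 * real n"
      unfolding len_sq by (metis of_int_add of_int_mult of_int_numeral of_int_of_nat_eq)
    have "n \<noteq> 0"
    proof
      assume "n = 0"
      then have "(len u)\<^sup>2 = 0" "(len v)\<^sup>2 = 0" using c by (simp_all add: sum_power2_eq_zero_iff)
      then show False using nz by (simp add: len_def zero_prod_def)
    qed
    then have mem: "(n, u + w, w) \<in> (SIGMA n:N. X n \<times> X n)" using b n c le by (simp add: N_def X_def)
    have "p = f (n, u + w, w)"
      unfolding p v f_def by (cases u; cases w) simp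
    then show "p \<in> f ` (SIGMA n:N. X n \<times> X n)" using mem by (rule image_eqI)
  qed
  finally show ?thesis by (simp only: N_def)
qed

lemma orthogonal_pairs_eq_fibres:
  assumes R: "R \<ge> 0"
  shows "orthogonal_pairs R = (SIGMA u:punctured True R. fibre u (sqrt (R\<^sup>2 - (len u)\<^sup>2))) \<union> {0} \<times> (fibre 0 R - {0})"
proof -
  have sq: "len v \<le> sqrt (R\<^sup>2 - (len u)\<^sup>2) \<and> len u \<le> R \<longleftrightarrow> (len u)\<^sup>2 + (len v)\<^sup>2 \<le> R\<^sup>2" for u v
  proof -
    have "len u \<le> R" if "(len u)\<^sup>2 + (len v)\<^sup>2 \<le> R\<^sup>2"
      using that R zero_le_power2[of "len v"] by (intro power2_le_imp_le[of "len u" R]) linarith+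
    moreover have "(len u)\<^sup>2 \<le> R\<^sup>2" if "len u \<le> R" using that by (simp add: power_mono)
    moreover have "len v \<le> sqrt (R\<^sup>2 - (len u)\<^sup>2) \<longleftrightarrow> (len v)\<^sup>2 \<le> R\<^sup>2 - (len u)\<^sup>2"
      by (metis abs_of_nonneg len_nonneg real_le_rsqrt sqrt_ge_absD)
    ultimately show ?thesis by linarith
  qed
  have l0: "len 0 = 0" by (simp add: len_def)
  show ?thesis
  proof (intro equalityI subsetI)
    fix p assume "p \<in> orthogonal_pairs R"
    then obtain u v where p: "p = (u, v)" and uv: "idot v u = 0" "\<exists>w. v = u + iscale 2 w"
      and nz: "(u, v) \<noteq> 0" and le: "(len u)\<^sup>2 + (len v)\<^sup>2 \<le> R\<^sup>2"
      by (auto simp: orthogonal_pairs_def)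
    show "p \<in> (SIGMA u:punctured True R. fibre u (sqrt (R\<^sup>2 - (len u)\<^sup>2))) \<union> {0} \<times> (fibre 0 R - {0})"
    proof (cases "u = 0")
      case True
      have "len v \<le> R" using le R True by (intro power2_le_imp_le[of "len v" R]) (simp_all add: l0)
      then show ?thesis using uv nz unfolding p True fibre_def pair_eq_0_iff by blast
    next
      case False
      have v: "v \<in> fibre u (sqrt (R\<^sup>2 - (len u)\<^sup>2))" and u: "len u \<le> R"
        using uv le sq[of v u] by (auto simp: fibre_def)
      have "u \<in> punctured True R" using False u fibre_parity[OF v] by (simp add: punctured_iff lat_def)
      then show ?thesis using v p by simp
    qed
  next
    fix p assume "p \<in> (SIGMA u:punctured True R. fibre u (sqrt (R\<^sup>2 - (len u)\<^sup>2))) \<union> {0} \<times> (fibre 0 R - {0})"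
    then consider u v where "p = (u, v)" "u \<in> punctured True R" "v \<in> fibre u (sqrt (R\<^sup>2 - (len u)\<^sup>2))"
      | v where "p = (0, v)" "v \<in> fibre 0 R" "v \<noteq> 0" by blast
    then show "p \<in> orthogonal_pairs R"
    proof cases
      case 1
      then show ?thesis using sq[of v u]
        unfolding orthogonal_pairs_def fibre_def punctured_iff pair_eq_0_iff by blast
    next
      case 2
      then have "(len 0)\<^sup>2 + (len v)\<^sup>2 \<le> R\<^sup>2" unfolding l0 by (auto simp: fibre_def intro!: power_mono)
      then show ?thesis using 2 unfolding orthogonal_pairs_def fibre_def pair_eq_0_iff by blast
    qed
  qed
qed

lemma fibre_estimate:
  assumes u: "u \<in> punctured True R" and T: "T > 0"
    and short: "\<And>w. w \<noteq> 0 \<Longrightarrow> idot w u = 0 \<Longrightarrow> T \<le> len w"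
  defines "F \<equiv> fibre u (sqrt (R\<^sup>2 - (len u)\<^sup>2))"
  shows "finite F" and "\<bar>real (card F) - pi / 4 * (vgcd u * (R\<^sup>2 - (len u)\<^sup>2) / len u)\<bar> \<le> 4 * R / T + 1"
proof -
  have u0: "u \<noteq> 0" "len u \<le> R" and ev: "even (idot u u)"
    using u by (auto simp: punctured_iff lat_def even_idot_self_iff simp del: idot.simps)
  have R: "R \<ge> 0" using u0(2) len_nonneg[of u] by linarith
  have p: "0 \<le> R\<^sup>2 - (len u)\<^sup>2" using u0(2) by (simp add: power_mono)
  then have r: "0 \<le> sqrt (R\<^sup>2 - (len u)\<^sup>2)" by simp
  have rR: "sqrt (R\<^sup>2 - (len u)\<^sup>2) \<le> R" using R by (intro real_le_lsqrt) auto
  note cf = card_fibre[OF u0(1) ev r T short, folded F_def]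
  show "finite F" by (rule cf(1))
  have "4 * sqrt (R\<^sup>2 - (len u)\<^sup>2) / T \<le> 4 * R / T" using rR T by (intro divide_right_mono) auto
  then show "\<bar>real (card F) - pi / 4 * (vgcd u * (R\<^sup>2 - (len u)\<^sup>2) / len u)\<bar> \<le> 4 * R / T + 1"
    using cf(2) p by simp
qed

text \<open>
  A coordinate of \<open>u\<close> at which \<open>w\<close> does not vanish is determined by the other two.
\<close>

lemma card_orthogonal_le:
  assumes w: "w \<noteq> 0" and R: "R \<ge> 0"
  shows "real (card {u \<in> punctured True R. idot w u = 0}) \<le> (2 * R + 1)\<^sup>2"
proof -
  define B where "B = {i::int. \<bar>of_int i + 0\<bar> \<le> R}"
  have fB: "finite B" unfolding B_def by (rule finite_int_interval)
  have cB: "real (card B) \<le> 2 * R + 1" using card_int_interval[OF R, of 0] by (simp add: B_def)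
  obtain a b c where abc: "w = (a, b, c)" by (cases w)
  define S where "S = {u \<in> punctured True R. idot w u = 0}"
  have box: "x \<in> B \<and> y \<in> B \<and> z \<in> B" if "(x, y, z) \<in> S" for x y z
  proof -
    have "(len (x, y, z))\<^sup>2 \<le> R\<^sup>2" using that R unfolding S_def by (intro power_mono) (auto simp: punctured_iff)
    then have le: "(real_of_int x)\<^sup>2 + (real_of_int y)\<^sup>2 + (real_of_int z)\<^sup>2 \<le> R\<^sup>2"
      unfolding len_sq by (simp add: power2_eq_square)
    have "(real_of_int x)\<^sup>2 \<le> R\<^sup>2" "(real_of_int y)\<^sup>2 \<le> R\<^sup>2" "(real_of_int z)\<^sup>2 \<le> R\<^sup>2"
      using le zero_le_power2[of "real_of_int x"] zero_le_power2[of "real_of_int y"] zero_le_power2[of "real_of_int z"]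
      by linarith+
    then show ?thesis using R by (simp add: B_def abs_le_square_iff[symmetric])
  qed
  obtain f :: "ivec \<Rightarrow> int \<times> int" where f: "inj_on f S" "f ` S \<subseteq> B \<times> B"
  proof -
    consider "c \<noteq> 0" | "b \<noteq> 0" | "a \<noteq> 0" using w abc by (auto simp: zero_prod_def)
    then show thesis
    proof cases
      case 1
      show thesis
      proof (rule that[of "\<lambda>(x, y, z). (x, y)"])
        show "inj_on (\<lambda>(x, y, z). (x, y)) S"
        proof (rule inj_onI, clarsimp)
          fix x y z z' assume "(x, y, z) \<in> S" "(x, y, z') \<in> S"
          then have "idot w (x, y, z) = 0" "idot w (x, y, z') = 0" by (simp_all add: S_def)
          then have "c * z = c * z'" unfolding abc idot.simps by linarith
          then show "z = z'" using 1 by simp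
        qed
        show "(\<lambda>(x, y, z). (x, y)) ` S \<subseteq> B \<times> B" using box by auto
      qed
    next
      case 2
      show thesis
      proof (rule that[of "\<lambda>(x, y, z). (x, z)"])
        show "inj_on (\<lambda>(x, y, z). (x, z)) S"
        proof (rule inj_onI, clarsimp)
          fix x y y' z assume "(x, y, z) \<in> S" "(x, y', z) \<in> S"
          then have "idot w (x, y, z) = 0" "idot w (x, y', z) = 0" by (simp_all add: S_def)
          then have "b * y = b * y'" unfolding abc idot.simps by linarith
          then show "y = y'" using 2 by simp
        qed
        show "(\<lambda>(x, y, z). (x, z)) ` S \<subseteq> B \<times> B" using box by auto
      qed
    next
      case 3
      show thesis
      proof (rule that[of "\<lambda>(x, y, z). (y, z)"])
        show "inj_on (\<lambda>(x, y, z). (y, z)) S"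
        proof (rule inj_onI, clarsimp)
          fix x x' y z assume "(x, y, z) \<in> S" "(x', y, z) \<in> S"
          then have "idot w (x, y, z) = 0" "idot w (x', y, z) = 0" by (simp_all add: S_def)
          then have "a * x = a * x'" unfolding abc idot.simps by linarith
          then show "x = x'" using 3 by simp
        qed
        show "(\<lambda>(x, y, z). (y, z)) ` S \<subseteq> B \<times> B" using box by auto
      qed
    qed
  qed
  have "card S \<le> card (B \<times> B)" using f fB by (intro card_inj_on_le[of f]) auto
  then have "real (card S) \<le> real (card B) * real (card B)"
    by (simp add: card_cartesian_product flip: of_nat_mult)
  also have "\<dots> \<le> (2 * R + 1) * (2 * R + 1)" using cB R by (intro mult_mono) auto
  finally show ?thesis by (simp add: S_def power2_eq_square)
qed

text \<open>
  The first error term bounds the fibre of \<open>u = 0\<close>. The second is the error of \<open>fibre_estimate\<close> for the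
  vectors \<open>u\<close> that are orthogonal to no nonzero vector shorter than \<open>T\<close>, summed over the whole ball. The third
  belongs to the exceptional \<open>u\<close>, for which the estimate is used with 1 in place of \<open>T\<close>.
\<close>

lemma card_orthogonal_pairs_estimate:
  assumes R: "R \<ge> 0" and T: "T > 0"
  shows "\<bar>real (card (orthogonal_pairs R)) - pi / 4 * main_term R\<bar>
    \<le> 140 * R ^ 3 + 140 * R ^ 3 * (4 * R / T + 1) + 140 * T ^ 3 * (2 * R + 1)\<^sup>2 * (4 * R + 1)"
proof -
  let ?P = "punctured True R" and ?F = "\<lambda>u. fibre u (sqrt (R\<^sup>2 - (len u)\<^sup>2))"
  let ?m = "\<lambda>u. vgcd u * (R\<^sup>2 - (len u)\<^sup>2) / len u"
  define bad where "bad = {u \<in> ?P. \<exists>w. w \<noteq> 0 \<and> idot w u = 0 \<and> len w < T}"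
  have fP: "finite ?P" by (rule finite_punctured)
  have fF: "finite (?F u)" if "u \<in> ?P" for u
    by (rule fibre_estimate(1)[OF that, of 1]) (auto simp: len_ge_1)
  have f0: "finite (fibre 0 R - {0})" by (rule finite_subset[OF fibre_zero_subset finite_punctured])
  have c0: "real (card (fibre 0 R - {0})) \<le> 140 * R ^ 3"
    using card_mono[OF finite_punctured fibre_zero_subset[of R]] card_punctured_le[OF R, of False] by linarith
  have "card (orthogonal_pairs R) = card (SIGMA u:?P. ?F u) + card ({0::ivec} \<times> (fibre 0 R - {0}))"
    unfolding orthogonal_pairs_eq_fibres[OF R] using fP fF f0
    by (intro card_Un_disjoint) (auto simp: punctured_iff)
  then have c: "real (card (orthogonal_pairs R)) = (\<Sum>u\<in>?P. real (card (?F u))) + real (card (fibre 0 R - {0}))"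
    using fP fF by (simp add: card_cartesian_product)
  have "\<bar>(\<Sum>u\<in>?P. real (card (?F u))) - pi / 4 * main_term R\<bar>
      = \<bar>\<Sum>u\<in>?P. (real (card (?F u)) - pi / 4 * ?m u)\<bar>"
    by (simp add: sum_subtractf main_term_def sum_distrib_left)
  also have "\<dots> \<le> (\<Sum>u\<in>?P. (4 * R / T + 1) + (if u \<in> bad then 4 * R + 1 else 0))"
  proof (rule order_trans[OF sum_abs], rule sum_mono)
    fix u assume u: "u \<in> ?P"
    show "\<bar>real (card (?F u)) - pi / 4 * ?m u\<bar> \<le> (4 * R / T + 1) + (if u \<in> bad then 4 * R + 1 else 0)"
    proof (cases "u \<in> bad")
      case True
      have "\<bar>real (card (?F u)) - pi / 4 * ?m u\<bar> \<le> 4 * R / 1 + 1"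
        by (rule fibre_estimate(2)[OF u]) (auto simp: len_ge_1)
      moreover have "4 * R / T \<ge> 0" using R T by simp
      ultimately show ?thesis using True by simp
    next
      case False
      have "\<bar>real (card (?F u)) - pi / 4 * ?m u\<bar> \<le> 4 * R / T + 1"
        by (rule fibre_estimate(2)[OF u T]) (use False u in \<open>force simp: bad_def\<close>)
      then show ?thesis using False by simp
    qed
  qed
  also have "\<dots> = real (card ?P) * (4 * R / T + 1) + real (card (?P \<inter> bad)) * (4 * R + 1)"
    using fP by (simp add: sum.distrib sum.If_cases)
  also have "\<dots> \<le> 140 * R ^ 3 * (4 * R / T + 1) + 140 * T ^ 3 * (2 * R + 1)\<^sup>2 * (4 * R + 1)"
  proof (intro add_mono mult_right_mono)
    show "real (card ?P) \<le> 140 * R ^ 3" by (rule card_punctured_le[OF R])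
    have "?P \<inter> bad \<subseteq> (\<Union>w\<in>punctured False T. {u \<in> ?P. idot w u = 0})"
    proof
      fix u assume "u \<in> ?P \<inter> bad"
      then obtain w where "u \<in> ?P" "w \<noteq> 0" "idot w u = 0" "len w < T" unfolding bad_def by blast
      moreover from this have "w \<in> punctured False T" by (simp add: punctured_iff lat_def)
      ultimately show "u \<in> (\<Union>w\<in>punctured False T. {u \<in> ?P. idot w u = 0})" by blast
    qed
    then have "card (?P \<inter> bad) \<le> card (\<Union>w\<in>punctured False T. {u \<in> ?P. idot w u = 0})"
      using fP finite_punctured by (intro card_mono) auto
    also have "\<dots> \<le> (\<Sum>w\<in>punctured False T. card {u \<in> ?P. idot w u = 0})"
      by (rule card_UN_le[OF finite_punctured])
    finally have "real (card (?P \<inter> bad)) \<le> (\<Sum>w\<in>punctured False T. real (card {u \<in> ?P. idot w u = 0}))"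
      by (simp flip: of_nat_sum)
    also have "\<dots> \<le> (\<Sum>w\<in>punctured False T. (2 * R + 1)\<^sup>2)"
      by (intro sum_mono card_orthogonal_le R) (auto simp: punctured_iff)
    also have "\<dots> = real (card (punctured False T)) * (2 * R + 1)\<^sup>2" by simp
    also have "\<dots> \<le> 140 * T ^ 3 * (2 * R + 1)\<^sup>2"
      using T by (intro mult_right_mono card_punctured_le) auto
    finally show "real (card (?P \<inter> bad)) \<le> 140 * T ^ 3 * (2 * R + 1)\<^sup>2" .
  qed (use R T in auto)
  finally show ?thesis using c c0 by linarith
qed

lemma card_orthogonal_pairs_asymptotics:
  "((\<lambda>R. real (card (orthogonal_pairs R)) / R ^ 4) \<longlongrightarrow> pi ^ 4 / (42 * riemann_zeta 3)) at_top"
proof -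
  have "((\<lambda>R. real (card (orthogonal_pairs R)) / R ^ 4 - pi / 4 * (main_term R / R ^ 4)) \<longlongrightarrow> 0) at_top"
  proof (rule tendstoI)
    fix \<epsilon> :: real assume \<epsilon>: "\<epsilon> > 0"
    \<comment> \<open>The term of order \<open>R\<^sup>4 / T\<close> has coefficient 560 and is to be at most half of \<open>\<epsilon>\<close>.\<close>
    define T where "T = 1120 / \<epsilon>"
    have T: "T > 0" using \<epsilon> by (simp add: T_def)
    define q where "q = 140 * T ^ 3"
    define g where "g = (\<lambda>R::real. 280 * R ^ 3 / R ^ 4 + q * ((2 * R + 1)\<^sup>2 * (4 * R + 1) / R ^ 4))"
    have 1: "((\<lambda>R::real. 280 * R ^ 3 / R ^ 4) \<longlongrightarrow> 0) at_top" by real_asymp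
    have 2: "((\<lambda>R::real. (2 * R + 1)\<^sup>2 * (4 * R + 1) / R ^ 4) \<longlongrightarrow> 0) at_top" by real_asymp
    have "(g \<longlongrightarrow> 0) at_top"
      unfolding g_def using tendsto_add[OF 1 tendsto_mult_left[OF 2, of q]] by simp
    then have "\<forall>\<^sub>F R in at_top. g R < \<epsilon> / 2" using \<epsilon> by (intro order_tendstoD(2)) auto
    with eventually_gt_at_top[of 0]
    show "\<forall>\<^sub>F R in at_top. dist (real (card (orthogonal_pairs R)) / R ^ 4 - pi / 4 * (main_term R / R ^ 4)) 0 < \<epsilon>"
    proof eventually_elim
      case (elim R)
      have R4: "R ^ 4 > 0" using elim by simp
      have "real (card (orthogonal_pairs R)) / R ^ 4 - pi / 4 * (main_term R / R ^ 4)
          = (real (card (orthogonal_pairs R)) - pi / 4 * main_term R) / R ^ 4"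
        by (simp add: diff_divide_distrib)
      then have "\<bar>real (card (orthogonal_pairs R)) / R ^ 4 - pi / 4 * (main_term R / R ^ 4)\<bar>
          = \<bar>real (card (orthogonal_pairs R)) - pi / 4 * main_term R\<bar> / R ^ 4"
        by (simp only: abs_divide abs_of_pos[OF R4])
      also have "\<dots> \<le> (140 * R ^ 3 + 140 * R ^ 3 * (4 * R / T + 1) + q * (2 * R + 1)\<^sup>2 * (4 * R + 1)) / R ^ 4"
        unfolding q_def using elim T by (intro divide_right_mono card_orthogonal_pairs_estimate) auto
      also have "\<dots> = g R + 560 / T"
        using elim T by (simp add: g_def field_simps power3_eq_cube power4_eq_xxxx)
      also have "560 / T = \<epsilon> / 2" using \<epsilon> by (simp add: T_def)
      finally show ?case using elim by simp
    qed
  qed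
  from tendsto_add[OF this tendsto_mult_left[OF main_term_asymptotics, of "pi / 4"]]
  show ?thesis by (simp add: power4_eq_xxxx power3_eq_cube field_simps)
qed

lemma riemann_zeta_3_pos: "riemann_zeta 3 > 0"
proof -
  have "(\<lambda>n. 1 / real (Suc n) powr 3) sums riemann_zeta 3" by (rule riemann_zeta_sums) simp
  then have "riemann_zeta 3 = (\<Sum>n. 1 / real (Suc n) powr 3)" "summable (\<lambda>n. 1 / real (Suc n) powr 3)"
    by (simp_all add: sums_iff)
  then show ?thesis using suminf_pos[of "\<lambda>n. 1 / real (Suc n) powr 3"] by simp
qed

theorem mainTheorem1:
  shows "(\<lambda>x::real. \<Sum>n | 0 < n \<and> real n \<le> x. (real (r3 n))\<^sup>2)
           \<sim>[at_top] (\<lambda>x::real. 8 * pi ^ 4 / (21 * riemann_zeta 3) * x\<^sup>2)"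
proof (rule asymp_equivI'_const)
  show "8 * pi ^ 4 / (21 * riemann_zeta 3) \<noteq> 0" using riemann_zeta_3_pos by simp
  have "filterlim (\<lambda>x::real. 2 * sqrt x) at_top at_top" by real_asymp
  from tendsto_mult_left[OF filterlim_compose[OF card_orthogonal_pairs_asymptotics this], of 16]
  have "((\<lambda>x. 16 * (real (card (orthogonal_pairs (2 * sqrt x))) / (2 * sqrt x) ^ 4))
      \<longlongrightarrow> 8 * pi ^ 4 / (21 * riemann_zeta 3)) at_top" by simp
  moreover have "\<forall>\<^sub>F x in at_top. 16 * (real (card (orthogonal_pairs (2 * sqrt x))) / (2 * sqrt x) ^ 4)
      = (\<Sum>n | 0 < n \<and> real n \<le> x. (real (r3 n))\<^sup>2) / x\<^sup>2"
    using eventually_gt_at_top[of 0]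
  proof eventually_elim
    case (elim x)
    have sq: "(2 * sqrt x)\<^sup>2 = 4 * x" using elim by (simp add: power_mult_distrib)
    have "(2 * sqrt x) ^ 4 = ((2 * sqrt x)\<^sup>2)\<^sup>2" by (simp flip: power_mult)
    then have p4: "(2 * sqrt x) ^ 4 = 16 * x\<^sup>2" unfolding sq by (simp add: power_mult_distrib)
    have "real (card (orthogonal_pairs (2 * sqrt x))) = (\<Sum>n | 0 < n \<and> real n \<le> x. (real (r3 n))\<^sup>2)"
      unfolding sum_r3_squared_eq_card_orthogonal_pairs[symmetric] sq by simp
    then show ?case unfolding p4 by simp
  qed
  ultimately show "((\<lambda>x. (\<Sum>n | 0 < n \<and> real n \<le> x. (real (r3 n))\<^sup>2) / x\<^sup>2)
      \<longlongrightarrow> 8 * pi ^ 4 / (21 * riemann_zeta 3)) at_top"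
    by (rule Lim_transform_eventually)
qed

end
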